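(* Let $r\ge 1$ and $p,k\ge 2$. Let $G=(N^k,\Theta)$ be a downward directed lattice graph and let $F: N^k\times(N^k\times N)^r\to N$ be a partial selection function. Let $S=\{\hat s_D\mid D\subset N^k,\ |D|<\infty\}$, where $\hat s_D$ is the label function determined by $G$, $F$ and $D$. Then some $f\in S$ has at most $k^k$ regressive values over some Cartesian power $E^k\subseteq\mathrm{domain}(f)$ with $E\subset N$, $|E|=p$. In fact, some $f\in S$ is regressively regular over some $E\subset N$ of cardinality $p$.
   Context: Background theory: ZFC together with the axiom "for every $n\ge 1$ there exists an $n$-subtle cardinal". Here a limit ordinal $\lambda$ is $n$-subtle if for every closed unbounded $C\subseteq\lambda$ and every function $S$ assigning to each $n$-element subset $A$ of $\lambda$ a set $S(A)\subseteq\min(A)$, there is an $(n+1)$-element set $B\subseteq C$ such that for all $n$-element subsets $A,A'$ of $B$, $S(A)\cap\min(A\cup A')=S(A')\cap\min(A\cup A')$. $N$ is the set of nonnegative integers. For $z=(n_1,\dots,n_k)\in N^k$, $\max(z)$ and $\min(z)$ are the maximum and minimum of its coordinates. A directed graph $G=(N^k,\Theta)$ is a downward directed lattice graph if every $(x,y)\in\Theta$ satisfies $\max(x)>\max(y)$. For $D\subset N^k$, $G_D=(D,\Theta_D)$ is the induced subgraph, $\Theta_D=\{(x,y)\in\Theta\mid x,y\in D\}$, and for $z\in D$, $G_D^z=\{x\mid (z,x)\in\Theta_D\}$. A partial selection function is a partial function $F:N^k\times(N^k\times N)^r\to N$ (its domain may be a proper subset) such that whenever $F(x,((y_1,n_1),\dots,(y_r,n_r)))$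 is defined, it equals $n_i$ for some $1\le i\le r$. For finite $D$, $\hat s_D:D\to N$ is defined recursively (on $\max(z)$): let $\Phi^D_z$ be the set of all defined values $F[z,(y_1,n_1),\dots,(y_r,n_r)]$ with all $y_i\in G_D^z$, where $n_i=\hat s_D(y_i)$ if $\Phi^D_{y_i}\ne\emptyset$ and $n_i=\min(y_i)$ if $\Phi^D_{y_i}=\emptyset$. If $\Phi^D_z=\emptyset$ then $\hat s_D(z)=\max(z)$; if $\Phi^D_z\neq\emptyset$ then $\hat s_D(z)=\min(\Phi^D_z)$. An integer $n$ is a regressive value of $f$ on $X\subseteq N^k$ if there is $x\in X$ with $f(x)=n<\min(x)$. Two tuples $x=(n_1,\dots,n_k)$, $y=(m_1,\dots,m_k)$ have the same order type if $\{(i,j)\mid n_i<n_j\}=\{(i,j)\mid m_i<m_j\}$ and $\{(i,j)\mid n_i=n_j\}=\{(i,j)\mid m_i=m_j\}$. For finite $D\subset N^k$ and $E\subset N$ with $E^k\subseteq D$, $f:D\to N$ is regressively regular over $E$ if for each order type $ot$ of $k$-tuples one of the following holds: (1) for all $x,y\in E^k$ of order type $ot$, $f(x)=f(y)<\min(E)$; (2) for all $x\in E^k$ of order type $ot$, $f(x)\ge\min(x)$. *)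

theory Defs
  imports "HOL-Library.NList" "HOL-Library.Equipollence"
begin

section \<open>Subtle cardinals\<close>

text \<open>Ordinals are the elements of an arbitrary well-ordered type; an element \<open>\<kappa>\<close> plays the role of
  the von Neumann ordinal \<open>{..<\<kappa>}\<close>. HOL proves no large cardinal axiom, so the existence of
  \<open>n\<close>-subtle cardinals is used as a hypothesis on such a type, which is satisfiable over the stated
  set-theoretic background theory.\<close>

definition limit_ordinal :: "'a::wellorder \<Rightarrow> bool" where
  "limit_ordinal \<kappa> \<longleftrightarrow> {..<\<kappa>} \<noteq> {} \<and> (\<forall>\<alpha><\<kappa>. \<exists>\<beta><\<kappa>. \<alpha> < \<beta>)"

definition cardinal_ordinal :: "'a::wellorder \<Rightarrow> bool" where
  "cardinal_ordinal \<kappa> \<longleftrightarrow> (\<forall>\<alpha><\<kappa>. \<not> {..<\<alpha>} \<approx> {..<\<kappa>})"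

definition unbounded_below :: "'a::wellorder set \<Rightarrow> 'a \<Rightarrow> bool" where
  "unbounded_below C \<kappa> \<longleftrightarrow> (\<forall>\<alpha><\<kappa>. \<exists>\<beta>\<in>C. \<alpha> < \<beta> \<and> \<beta> < \<kappa>)"

definition closed_unbounded :: "'a::wellorder set \<Rightarrow> 'a \<Rightarrow> bool" where
  "closed_unbounded C \<kappa> \<longleftrightarrow> C \<subseteq> {..<\<kappa>} \<and> unbounded_below C \<kappa> \<and>
     (\<forall>\<delta><\<kappa>. limit_ordinal \<delta> \<and> unbounded_below C \<delta> \<longrightarrow> \<delta> \<in> C)"

definition n_subtle :: "nat \<Rightarrow> 'a::wellorder \<Rightarrow> bool" where
  "n_subtle n \<kappa> \<longleftrightarrow> limit_ordinal \<kappa> \<and>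
     (\<forall>C S. closed_unbounded C \<kappa> \<and>
        (\<forall>A. A \<subseteq> {..<\<kappa>} \<and> finite A \<and> card A = n \<longrightarrow> S A \<subseteq> {..<Min A}) \<longrightarrow>
        (\<exists>B. B \<subseteq> C \<and> finite B \<and> card B = n + 1 \<and>
           (\<forall>A A'. A \<subseteq> B \<and> card A = n \<and> A' \<subseteq> B \<and> card A' = n \<longrightarrow>
              S A \<inter> {..<Min (A \<union> A')} = S A' \<inter> {..<Min (A \<union> A')})))"

definition n_subtle_cardinal :: "nat \<Rightarrow> 'a::wellorder \<Rightarrow> bool" where
  "n_subtle_cardinal n \<kappa> \<longleftrightarrow> cardinal_ordinal \<kappa> \<and> n_subtle n \<kappa>"


section \<open>Downward directed lattice graphs and label functions\<close>

text \<open>Tuples are lists: \<open>E\<^sup>k\<close> is \<^term>\<open>nlists k E\<close>, and \<open>N\<^sup>k\<close> is \<^term>\<open>nlists k (UNIV :: nat set)\<close>.\<close>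

abbreviation max_t :: "nat list \<Rightarrow> nat" where "max_t z \<equiv> Max (set z)"
abbreviation min_t :: "nat list \<Rightarrow> nat" where "min_t z \<equiv> Min (set z)"

definition downward_lattice_graph :: "nat \<Rightarrow> (nat list \<times> nat list) set \<Rightarrow> bool" where
  "downward_lattice_graph k \<Theta> \<longleftrightarrow> \<Theta> \<subseteq> nlists k UNIV \<times> nlists k UNIV \<and>
     (\<forall>(x, y)\<in>\<Theta>. max_t x > max_t y)"

definition out_nbrs :: "(nat list \<times> nat list) set \<Rightarrow> nat list set \<Rightarrow> nat list \<Rightarrow> nat list set" where
  "out_nbrs \<Theta> D z = {x. (z, x) \<in> Restr \<Theta> D}"

type_synonym selection = "nat list \<times> (nat list \<times> nat) list \<Rightarrow> nat option"

definition partial_selection :: "nat \<Rightarrow> nat \<Rightarrow> selection \<Rightarrow> bool" where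
  "partial_selection k r F \<longleftrightarrow> dom F \<subseteq> nlists k UNIV \<times> nlists r (nlists k UNIV \<times> UNIV) \<and>
     (\<forall>x ys v. F (x, ys) = Some v \<longrightarrow> (\<exists>i<r. v = snd (ys ! i)))"

definition label_of :: "nat set \<Rightarrow> nat list \<Rightarrow> nat" where
  "label_of \<Phi> z = (if \<Phi> = {} then max_t z else Inf \<Phi>)"

definition input_of :: "nat set \<Rightarrow> nat list \<Rightarrow> nat" where
  "input_of \<Phi> y = (if \<Phi> \<noteq> {} then label_of \<Phi> y else min_t y)"

text \<open>The label of \<open>z\<close> is determined by \<open>z\<close> and the set \<open>\<Phi>\<^sub>z\<close>, so it suffices to define \<open>\<Phi>\<close> by
  recursion on the maximum of the tuple. The recursion in its usual form, jointly for
  \<open>\<Phi>\<close> and the label function, is \<open>Phi_rec\<close> and \<open>label_fun_eq\<close> below.\<close>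

definition Phi :: "nat \<Rightarrow> (nat list \<times> nat list) set \<Rightarrow> selection \<Rightarrow> nat list set \<Rightarrow> nat list \<Rightarrow> nat set"
  where "Phi r \<Theta> F D = wfrec (measure max_t)
     (\<lambda>\<phi> z. {v. \<exists>ys\<in>nlists r (out_nbrs \<Theta> D z).
               F (z, map (\<lambda>y. (y, input_of (\<phi> y) y)) ys) = Some v})"

definition label_fun ::
  "nat \<Rightarrow> (nat list \<times> nat list) set \<Rightarrow> selection \<Rightarrow> nat list set \<Rightarrow> nat list \<rightharpoonup> nat" where
  "label_fun r \<Theta> F D = (\<lambda>z. if z \<in> D then Some (label_of (Phi r \<Theta> F D z) z) else None)"

lemma Phi_rec:
  assumes "downward_lattice_graph k \<Theta>"
  shows "Phi r \<Theta> F D z =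
    {v. \<exists>ys\<in>nlists r (out_nbrs \<Theta> D z).
          F (z, map (\<lambda>y. (y, if Phi r \<Theta> F D y \<noteq> {} then the (label_fun r \<Theta> F D y) else min_t y)) ys)
            = Some v}"
proof -
  let ?H = "\<lambda>\<phi> z. {v. \<exists>ys\<in>nlists r (out_nbrs \<Theta> D z).
               F (z, map (\<lambda>y. (y, input_of (\<phi> y) y)) ys) = Some v}"
  have eq: "map (\<lambda>y. (y, input_of (cut (Phi r \<Theta> F D) (measure max_t) z y) y)) ys =
      map (\<lambda>y. (y, if Phi r \<Theta> F D y \<noteq> {} then the (label_fun r \<Theta> F D y) else min_t y)) ys"
    if "ys \<in> nlists r (out_nbrs \<Theta> D z)" for ys
  proof (rule map_cong[OF refl])
    fix y assume "y \<in> set ys"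
    then have "y \<in> out_nbrs \<Theta> D z" using nlistsE_set[OF that] by blast
    then have "(z, y) \<in> \<Theta>" "y \<in> D" by (auto simp: out_nbrs_def)
    then have "(y, z) \<in> measure max_t" "y \<in> D"
      using assms by (auto simp: downward_lattice_graph_def)
    then show "(y, input_of (cut (Phi r \<Theta> F D) (measure max_t) z y) y) =
        (y, if Phi r \<Theta> F D y \<noteq> {} then the (label_fun r \<Theta> F D y) else min_t y)"
      by (simp only: cut_apply) (simp add: input_of_def label_fun_def)
  qed
  have "Phi r \<Theta> F D z = ?H (cut (Phi r \<Theta> F D) (measure max_t) z) z"
    unfolding Phi_def by (subst wfrec) simp_all
  also have "\<dots> = {v. \<exists>ys\<in>nlists r (out_nbrs \<Theta> D z).
          F (z, map (\<lambda>y. (y, if Phi r \<Theta> F D y \<noteq> {} then the (label_fun r \<Theta> F D y) else min_t y)) ys)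
            = Some v}"
    by (intro Collect_cong bex_cong refl) (simp only: eq)
  finally show ?thesis .
qed

lemma label_fun_eq:
  "z \<in> D \<Longrightarrow> label_fun r \<Theta> F D z =
    Some (if Phi r \<Theta> F D z = {} then max_t z else Inf (Phi r \<Theta> F D z))"
  by (simp add: label_fun_def label_of_def)

lemma dom_label_fun: "dom (label_fun r \<Theta> F D) = D"
  by (auto simp: label_fun_def split: if_splits)

definition label_functions ::
  "nat \<Rightarrow> nat \<Rightarrow> (nat list \<times> nat list) set \<Rightarrow> selection \<Rightarrow> (nat list \<rightharpoonup> nat) set" where
  "label_functions k r \<Theta> F = {label_fun r \<Theta> F D | D. D \<subseteq> nlists k UNIV \<and> finite D}"


section \<open>Regressive values and regressive regularity\<close>

definition regressive_values :: "(nat list \<rightharpoonup> nat) \<Rightarrow> nat list set \<Rightarrow> nat set" where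
  "regressive_values f X = {n. \<exists>x\<in>X. f x = Some n \<and> n < min_t x}"

definition order_type :: "nat list \<Rightarrow> (nat \<times> nat) set \<times> (nat \<times> nat) set" where
  "order_type x =
     ({(i, j). i < length x \<and> j < length x \<and> x ! i < x ! j},
      {(i, j). i < length x \<and> j < length x \<and> x ! i = x ! j})"

definition regressively_regular :: "nat \<Rightarrow> (nat list \<rightharpoonup> nat) \<Rightarrow> nat set \<Rightarrow> bool" where
  "regressively_regular k f E \<longleftrightarrow> nlists k E \<subseteq> dom f \<and>
     (\<forall>ot \<in> order_type ` nlists k UNIV.
        (\<forall>x\<in>nlists k E. \<forall>y\<in>nlists k E. order_type x = ot \<and> order_type y = ot \<longrightarrow>
            the (f x) = the (f y) \<and> the (f y) < Min E) \<or>
        (\<forall>x\<in>nlists k E. order_type x = ot \<longrightarrow> the (f x) \<ge> min_t x))"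

end

theory Submission
  imports Defs "HOL-Library.Ramsey"
begin

text \<open>
  By Ramsey's theorem the graph and the selection function may be restricted to an infinite set \<open>H\<close> of
  integers on which they depend only on the order type of their arguments. They then make sense on
  tuples over any well-order, where the label of every tuple of the infinite graph of all \<open>k\<close>-tuples is
  again defined by recursion on the maximum. On a subtle ordinal this label function has
  regressively regular sets of every finite size. Each label is determined by finitely many tuples
  of decreasing maximum, so a finite set of tuples suffices to compute the labels on such a set, and
  an order embedding of its coordinates into \<open>H\<close> turns it into a finite set of integer tuples.
\<close>

(* Unfolding nlists_def makes the simplifier loop on these conditional rules. *)
declare nlistsE_length [simp del] nlistsE_set [simp del]

section \<open>Strictly monotone maps\<close>

text \<open>Moving labels between integers and ordinals is possible because a selection function
  returns one of its inputs and all defaults are coordinates: every label is an entry of some tuple,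
  and only comparisons of entries are ever evaluated. The graph and the selection function are
  merged into one relation on instances, an instance being one evaluation of the function together
  with its edges; it has a bounded number of entries, so one use of Ramsey's theorem suffices. The
  obstacle is that a label depends on the domain, since removing tuples can remove selected values.
  But a label is a least selected value, so it survives as soon as one list of tuples realising this
  value is kept. Regularity itself uses nothing about labels. It holds for every function from
  tuples to ordinals, because an ordinal is the initial segment below it and a regressive value is
  therefore a regressive set.\<close>

lemma strict_mono_on_less_iff:
  fixes e :: "'a::linorder \<Rightarrow> 'b::linorder"
  assumes "strict_mono_on W e" "x \<in> W" "y \<in> W"
  shows "e x < e y \<longleftrightarrow> x < y"
  using assms by (metis strict_mono_onD not_less_iff_gr_or_eq)

lemma strict_mono_on_Max:
  fixes e :: "'a::linorder \<Rightarrow> 'b::linorder"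
  assumes "strict_mono_on W e" "X \<subseteq> W" "finite X" "X \<noteq> {}"
  shows "Max (e ` X) = e (Max X)"
proof (rule Max_eqI)
  fix y assume "y \<in> e ` X"
  then obtain x where "x \<in> X" "y = e x" by blast
  then show "y \<le> e (Max X)"
    using assms strict_mono_on_less_eq[OF assms(1), of x "Max X"] Max_in Max_ge by blast
qed (use assms in auto)

lemma strict_mono_on_Min:
  fixes e :: "'a::linorder \<Rightarrow> 'b::linorder"
  assumes "strict_mono_on W e" "X \<subseteq> W" "finite X" "X \<noteq> {}"
  shows "Min (e ` X) = e (Min X)"
proof (rule Min_eqI)
  fix y assume "y \<in> e ` X"
  then obtain x where "x \<in> X" "y = e x" by blast
  then show "e (Min X) \<le> y"
    using assms strict_mono_on_less_eq[OF assms(1), of "Min X" x] Min_in Min_le by blast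
qed (use assms in auto)

lemma strict_mono_on_Least:
  fixes e :: "'a::wellorder \<Rightarrow> nat"
  assumes "strict_mono_on W e" "X \<subseteq> W" "x \<in> X"
  shows "Inf (e ` X) = e (LEAST x. x \<in> X)"
proof (rule cInf_eq_minimum)
  have L: "(LEAST x. x \<in> X) \<in> X" using assms(3) by (rule LeastI)
  then show "e (LEAST x. x \<in> X) \<in> e ` X" by (rule imageI)
  fix y assume "y \<in> e ` X"
  then obtain u where u: "u \<in> X" "y = e u" by blast
  then have "(LEAST x. x \<in> X) \<le> u" by (intro Least_le)
  then show "e (LEAST x. x \<in> X) \<le> y"
    using strict_mono_on_less_eq[OF assms(1), of "LEAST x. x \<in> X" u] L u assms(2) by blast
qed

lemma sorted_list_of_set_image_lessThan:
  fixes e :: "nat \<Rightarrow> 'a::linorder"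
  assumes "strict_mono_on {..<m} e"
  shows "sorted_list_of_set (e ` {..<m}) = map e [0..<m]"
proof (rule strict_sorted_equal)
  show "sorted_wrt (<) (map e [0..<m])"
    using assms by (auto simp: sorted_wrt_iff_nth_less strict_mono_on_def)
  show "sorted_wrt (<) (sorted_list_of_set (e ` {..<m}))" by simp
qed auto

text \<open>For finite \<open>W\<close> this is the order isomorphism onto
  \<open>{..<card W}\<close>. It turns an instance or a tuple over any linear order into an integer
  pattern.\<close>

definition rank_in :: "'a::linorder set \<Rightarrow> 'a \<Rightarrow> nat" where
  "rank_in W x = card {y \<in> W. y < x}"

lemma rank_in_strict_mono:
  assumes "finite W"
  shows "strict_mono_on W (rank_in W)"
proof (rule strict_mono_onI)
  fix x y assume "x \<in> W" "y \<in> W" "x < y"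
  then have "{z \<in> W. z < x} \<subset> {z \<in> W. z < y}" by auto
  then show "rank_in W x < rank_in W y"
    unfolding rank_in_def using assms by (intro psubset_card_mono) auto
qed

lemma rank_in_less_card: "finite W \<Longrightarrow> x \<in> W \<Longrightarrow> rank_in W x < card W"
  unfolding rank_in_def by (rule psubset_card_mono) auto

lemma rank_in_image:
  assumes "finite W"
  shows "rank_in W ` W = {..<card W}"
proof (rule card_subset_eq)
  show "rank_in W ` W \<subseteq> {..<card W}" using rank_in_less_card[OF assms] by auto
  show "card (rank_in W ` W) = card {..<card W}"
    using strict_mono_on_imp_inj_on[OF rank_in_strict_mono[OF assms]] by (simp add: card_image)
qed simp

lemma ex_strict_mono_on_infinite:
  fixes W :: "'a::linorder set" and H :: "nat set"
  assumes "finite W" "infinite H"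
  obtains e where "strict_mono_on W e" "e ` W \<subseteq> H"
proof
  show "strict_mono_on W (enumerate H \<circ> rank_in W)"
    using strict_mono_onD[OF rank_in_strict_mono[OF assms(1)]] assms(2)
    by (auto intro!: strict_mono_onI)
  show "(enumerate H \<circ> rank_in W) ` W \<subseteq> H" using enumerate_in_set[OF assms(2)] by auto
qed

text \<open>Ramsey's theorem speaks of sets of one fixed size, whereas an instance may have fewer
  coordinates. Extending its embedding to an infinite increasing sequence in \<open>H\<close>
  supplies the missing elements.\<close>

lemma strict_mono_on_rank_extension:
  fixes W :: "'a::linorder set" and H :: "nat set" and E :: "'a \<Rightarrow> nat"
  assumes "finite W" "infinite H" "strict_mono_on W E" "E ` W \<subseteq> H"
  obtains e where "strict_mono e" "range e \<subseteq> H" "\<And>x. x \<in> W \<Longrightarrow> e (rank_in W x) = E x"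
proof -
  \<comment> \<open>Since \<open>enumerate H m\<close> is at least \<open>m\<close>, the shift by
    more than the maximum of the old values puts the new values above them; \<open>insert 0\<close>
    covers an empty \<open>W\<close>.\<close>
  define e where "e i = (if i < card W then E (the_inv_into W (rank_in W) i)
      else enumerate H (i + Suc (Max (insert 0 (E ` W)))))" for i
  note inj = strict_mono_on_imp_inj_on[OF rank_in_strict_mono[OF assms(1)]]
  have eq: "e (rank_in W x) = E x" if "x \<in> W" for x
    using that rank_in_less_card[OF assms(1)] by (simp add: e_def the_inv_into_f_f[OF inj])
  have low: "\<exists>x\<in>W. rank_in W x = i" if "i < card W" for i
    using that rank_in_image[OF assms(1)] by (metis imageE lessThan_iff)
  have "strict_mono e"
  proof (rule strict_monoI)
    fix i j :: nat assume "i < j"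
    consider "j < card W" | "i < card W" "card W \<le> j" | "card W \<le> i" using \<open>i < j\<close> by linarith
    then show "e i < e j"
    proof cases
      case 1
      then obtain x y where "x \<in> W" "y \<in> W" "rank_in W x = i" "rank_in W y = j"
        using low \<open>i < j\<close> by (meson less_trans)
      then show ?thesis
        using \<open>i < j\<close> eq strict_mono_on_less_iff[OF rank_in_strict_mono[OF assms(1)], of x y]
          strict_mono_onD[OF assms(3), of x y] by auto
    next
      case 2
      then obtain x where x: "x \<in> W" "rank_in W x = i" using low by blast
      have "e i \<le> Max (insert 0 (E ` W))" using x eq assms(1) by (intro Max_ge) auto
      also have "\<dots> < j + Suc (Max (insert 0 (E ` W)))" by simp
      also have "\<dots> \<le> e j" using 2 le_enumerate[OF assms(2)] by (simp add: e_def)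
      finally show ?thesis .
    next
      case 3
      then show ?thesis using \<open>i < j\<close> assms(2) by (simp add: e_def)
    qed
  qed
  moreover have "range e \<subseteq> H"
  proof
    fix v assume "v \<in> range e"
    then obtain i where "v = e i" by blast
    then show "v \<in> H"
      using low[of i] eq assms(4) enumerate_in_set[OF assms(2)]
      by (cases "i < card W") (blast, simp add: e_def)
  qed
  ultimately show ?thesis using that eq by blast
qed

section \<open>Order-invariant instances\<close>

text \<open>One evaluation: a tuple, its neighbours with their inputs, and the resulting value. A
  datatype provides the set of all coordinates and the coordinatewise map at once.\<close>

datatype (set_inst: 'a) inst = Inst "'a list" "('a list \<times> 'a) list" 'a
  for map: map_inst

definition instances :: "nat \<Rightarrow> nat \<Rightarrow> 'a set \<Rightarrow> 'a inst set" where
  "instances k r U = {Inst z ys v | z ys v. z \<in> nlists k U \<and> ys \<in> nlists r (nlists k U \<times> U) \<and> v \<in> U}"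

lemma finite_nlists: "finite U \<Longrightarrow> finite (nlists k U)"
  unfolding nlists_def using finite_lists_length_eq[of U k] by (simp add: conj_commute)

lemma finite_instances:
  assumes "finite U"
  shows "finite (instances k r U)"
proof -
  have "instances k r U =
      (\<lambda>(z, ys, v). Inst z ys v) ` (nlists k U \<times> nlists r (nlists k U \<times> U) \<times> U)"
    unfolding instances_def by (auto simp: image_iff)
  then show ?thesis using assms by (simp add: finite_nlists)
qed

lemma instances_map:
  assumes "s \<in> instances k r U"
  shows "map_inst e s \<in> instances k r (e ` U)"
  using assms unfolding instances_def nlists_def by (fastforce simp: image_iff)

lemma instances_set:
  assumes "s \<in> instances k r U"
  shows "s \<in> instances k r (set_inst s)"
  using assms unfolding instances_def nlists_def by fastforce

lemma instances_mono: "U \<subseteq> V \<Longrightarrow> instances k r U \<subseteq> instances k r V"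
  unfolding instances_def nlists_def by fastforce

lemma finite_set_inst: "finite (set_inst s)"
  by (cases s) auto

text \<open>One value, \<open>k\<close> entries of the tuple, and \<open>k + 1\<close> numbers for
  each of the \<open>r\<close> pairs.\<close>

lemma card_set_inst:
  assumes "s \<in> instances k r U"
  shows "card (set_inst s) \<le> 1 + k + r * (k + 1)"
proof -
  obtain z ys v where s: "s = Inst z ys v" "length z = k" "length ys = r"
    "\<And>y. y \<in> set ys \<Longrightarrow> length (fst y) = k"
    using assms unfolding instances_def nlists_def by fastforce
  have "set_inst s = set (v # z @ concat (map (\<lambda>(y, n). n # y) ys))"
    using s(1) by (fastforce simp: image_iff)
  then have "card (set_inst s) \<le> 1 + k + length (concat (map (\<lambda>(y, n). n # y) ys))"
    using card_length[of "v # z @ concat (map (\<lambda>(y, n). n # y) ys)"] s(2) by simp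
  also have "length (concat (map (\<lambda>(y, n). n # y) ys)) = length ys * (k + 1)"
    using s(4) by (induction ys) (auto simp: case_prod_beta)
  finally show ?thesis using s(3) by simp
qed

text \<open>The instances range over an abstract order and only their images lie in
  \<open>H\<close>; this makes the truth of an instance over ordinals well defined.\<close>

definition order_invariant :: "nat set \<Rightarrow> nat inst set \<Rightarrow> 'a::linorder inst set \<Rightarrow> bool" where
  "order_invariant H R X \<longleftrightarrow> (\<forall>s\<in>X. \<forall>e e'. strict_mono_on (set_inst s) e \<and> e ` set_inst s \<subseteq> H \<and>
     strict_mono_on (set_inst s) e' \<and> e' ` set_inst s \<subseteq> H \<longrightarrow> (map_inst e s \<in> R \<longleftrightarrow> map_inst e' s \<in> R))"

text \<open>Replacing coordinates by ranks leaves finitely many patterns. Colour an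
  \<open>M\<close>-element set by the patterns that hold in \<open>R\<close> when the index
  \<open>i\<close> is read as its element of rank \<open>i\<close>; on a homogeneous
  \<open>H\<close> the same patterns hold everywhere.\<close>

theorem ex_order_invariant:
  fixes R :: "nat inst set"
  obtains H where "infinite H" "order_invariant H R (instances k r (UNIV :: 'a::linorder set))"
proof -
  define M where "M = 1 + k + r * (k + 1)"
  define T where "T = instances k r {..<M}"
  define col where "col X = {s \<in> T. map_inst (nth (sorted_list_of_set X)) s \<in> R}" for X
  \<comment> \<open>Colours have to be integers below a bound, so \<open>h\<close> numbers the sets
    of patterns.\<close>
  have "finite (Pow T)" unfolding T_def by (simp add: finite_instances)
  then obtain h :: "nat inst set \<Rightarrow> nat" and q where h: "bij_betw h (Pow T) {..<q}"
    using ex_bij_betw_finite_nat lessThan_atLeast0 by metis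
  have "\<forall>X. X \<subseteq> UNIV \<and> finite X \<and> card X = M \<longrightarrow> h (col X) < q"
    using bij_betwE[OF h] by (auto simp: col_def)
  then obtain H c where H: "infinite H" "\<And>X. X \<subseteq> H \<Longrightarrow> finite X \<Longrightarrow> card X = M \<Longrightarrow> h (col X) = c"
    using Ramsey[of "UNIV :: nat set" M "\<lambda>X. h (col X)" q] by (auto simp: infinite_UNIV_nat)
  have col_eq: "col X = {s \<in> T. map_inst e s \<in> R}"
    if "strict_mono e" "X = e ` {..<M}" for e and X :: "nat set"
  proof -
    have "map_inst (nth (sorted_list_of_set X)) s = map_inst e s" if "s \<in> T" for s
    proof (rule inst.map_cong0)
      fix i assume "i \<in> set_inst s"
      then have "i < M" using \<open>s \<in> T\<close> unfolding T_def instances_def nlists_def by fastforce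
      moreover have "strict_mono_on {..<M} e"
        using \<open>strict_mono e\<close> by (auto simp: strict_mono_on_def strict_mono_def)
      ultimately show "sorted_list_of_set X ! i = e i"
        using sorted_list_of_set_image_lessThan \<open>X = e ` {..<M}\<close> by fastforce
    qed
    then show ?thesis by (auto simp: col_def)
  qed
  have "order_invariant H R (instances k r (UNIV :: 'a set))"
    unfolding order_invariant_def
  proof (intro ballI allI impI, elim conjE)
    fix s :: "'a inst" and E E'
    assume s: "s \<in> instances k r UNIV"
      and E: "strict_mono_on (set_inst s) E" "E ` set_inst s \<subseteq> H"
      and E': "strict_mono_on (set_inst s) E'" "E' ` set_inst s \<subseteq> H"
    define t where "t = map_inst (rank_in (set_inst s)) s"
    have "rank_in (set_inst s) ` set_inst s \<subseteq> {..<M}"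
      using card_set_inst[OF s] by (auto simp: rank_in_image[OF finite_set_inst] M_def)
    then have tT: "t \<in> T"
      using instances_map[OF instances_set[OF s], of "rank_in (set_inst s)"]
        instances_mono unfolding T_def t_def by blast
    \<comment> \<open>The right-hand side no longer mentions \<open>G\<close>: the pattern of
      \<open>s\<close> belongs to the set of patterns with colour \<open>c\<close>.\<close>
    have iff: "map_inst G s \<in> R \<longleftrightarrow> t \<in> inv_into (Pow T) h c"
      if G: "strict_mono_on (set_inst s) G" "G ` set_inst s \<subseteq> H" for G
    proof -
      obtain e where e: "strict_mono e" "range e \<subseteq> H"
        "\<And>x. x \<in> set_inst s \<Longrightarrow> e (rank_in (set_inst s) x) = G x"
        using strict_mono_on_rank_extension[OF finite_set_inst H(1) G] by metis
      have "card (e ` {..<M}) = M"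
        using strict_mono_imp_inj_on[OF e(1)] by (simp add: card_image inj_on_subset)
      then have "h (col (e ` {..<M})) = c" using H(2)[of "e ` {..<M}"] e(2) by auto
      then have "col (e ` {..<M}) = inv_into (Pow T) h c"
        using bij_betw_inv_into_left[OF h, of "col (e ` {..<M})"] by (auto simp: col_def)
      moreover have "map_inst e t = map_inst G s"
        unfolding t_def inst.map_comp by (rule inst.map_cong0) (simp add: e(3))
      ultimately show ?thesis using col_eq[OF e(1) refl] tT by (metis (no_types, lifting) mem_Collect_eq)
    qed
    show "map_inst E s \<in> R \<longleftrightarrow> map_inst E' s \<in> R" using iff[OF E] iff[OF E'] by simp
  qed
  then show ?thesis using that H(1) by blast
qed

section \<open>Homogeneity below a subtle ordinal\<close>

definition succ_ord :: "'a::wellorder \<Rightarrow> 'a" where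
  "succ_ord x = (LEAST y. x < y)"

text \<open>A greatest element of the type has no successor. The hypothesis excludes this case, and
  the upper bounds in the lemmas below serve the same purpose.\<close>

lemma succ_ord_greater: "x < y \<Longrightarrow> x < succ_ord x"
  unfolding succ_ord_def by (rule LeastI)

lemma succ_ord_le: "x < y \<Longrightarrow> succ_ord x \<le> y"
  unfolding succ_ord_def by (rule Least_le)

lemma succ_ord_inj: "x < u \<Longrightarrow> y < u \<Longrightarrow> succ_ord x = succ_ord y \<Longrightarrow> x = y"
  by (metis succ_ord_greater succ_ord_le leD neqE)

text \<open>Zero or limit: unlike \<open>limit_ordinal\<close>, this includes the least element,
  which is the limit part of the finite ordinals.\<close>

definition no_pred :: "'a::wellorder \<Rightarrow> bool" where
  "no_pred x \<longleftrightarrow> (\<forall>y<x. \<exists>z<x. y < z)"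

lemma no_pred_succ_ord: "no_pred u \<Longrightarrow> x < u \<Longrightarrow> succ_ord x < u"
  unfolding no_pred_def by (meson succ_ord_le le_less_trans)

lemma no_pred_funpow: "no_pred u \<Longrightarrow> x < u \<Longrightarrow> (succ_ord ^^ m) x < u"
  by (induction m) (auto intro: no_pred_succ_ord)

lemma limit_decomposition: "\<exists>L m. no_pred L \<and> L \<le> x \<and> x = (succ_ord ^^ m) L" for x :: "'a::wellorder"
proof (induction x rule: less_induct)
  case (less x)
  show ?case
  proof (cases "no_pred x")
    case True
    then show ?thesis by (intro exI[of _ x] exI[of _ 0]) simp
  next
    case False
    then obtain y where y: "y < x" "\<And>z. z < x \<Longrightarrow> \<not> y < z" by (auto simp: no_pred_def)
    then have "x = succ_ord y"
      using succ_ord_greater[OF y(1)] succ_ord_le[OF y(1)] by (metis order_le_less)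
    moreover obtain L m where "no_pred L" "L \<le> y" "y = (succ_ord ^^ m) L"
      using less y(1) by blast
    ultimately show ?thesis using y(1) by (intro exI[of _ L] exI[of _ "Suc m"]) simp
  qed
qed

text \<open>Cancel successors on both sides; neither side can run out first, since \<open>L\<close>
  and \<open>L'\<close> are not successors. The bound \<open>u\<close> keeps all iterated successors
  where \<open>succ_ord\<close> is injective.\<close>

lemma limit_decomposition_unique:
  fixes u :: "'a::wellorder"
  assumes "no_pred u" "no_pred L" "no_pred L'" "L < u" "L' < u"
    and "(succ_ord ^^ m) L = (succ_ord ^^ m') L'"
  shows "L = L' \<and> m = m'"
  using assms(6)
proof (induction m arbitrary: m')
  case 0
  show ?case
  proof (cases m')
    case (Suc n)
    then have eq: "L = succ_ord ((succ_ord ^^ n) L')" using 0 by simp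
    have "(succ_ord ^^ n) L' < L"
      unfolding eq by (rule succ_ord_greater[OF no_pred_funpow[OF assms(1,5)]])
    then show ?thesis using no_pred_succ_ord[OF assms(2)] eq by fastforce
  qed (use 0 in simp)
next
  case (Suc m)
  show ?case
  proof (cases m')
    case 0
    then have eq: "L' = succ_ord ((succ_ord ^^ m) L)" using Suc.prems by simp
    have "(succ_ord ^^ m) L < L'"
      unfolding eq by (rule succ_ord_greater[OF no_pred_funpow[OF assms(1,4)]])
    then show ?thesis using no_pred_succ_ord[OF assms(3)] eq by fastforce
  next
    case (Suc n)
    then have "(succ_ord ^^ m) L = (succ_ord ^^ n) L'"
      using Suc.prems succ_ord_inj[OF no_pred_funpow[OF assms(1,4)] no_pred_funpow[OF assms(1,5)]]
      by simp
    then show ?thesis using Suc.IH Suc by blast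
  qed
qed

text \<open>Regressiveness is asked of all sets, even those whose minimum is unspecified; set
  functions defined with the condition \<open>\<xi> < Min A\<close> satisfy it outright.\<close>

lemma n_subtleE:
  assumes "n_subtle n \<kappa>" "closed_unbounded C \<kappa>" "\<And>A. S A \<subseteq> {..<Min A}"
  obtains B where "B \<subseteq> C" "finite B" "card B = n + 1"
    "\<And>A A'. A \<subseteq> B \<Longrightarrow> card A = n \<Longrightarrow> A' \<subseteq> B \<Longrightarrow> card A' = n \<Longrightarrow>
        S A \<inter> {..<Min (A \<union> A')} = S A' \<inter> {..<Min (A \<union> A')}"
proof -
  have "\<exists>B. B \<subseteq> C \<and> finite B \<and> card B = n + 1 \<and>
      (\<forall>A A'. A \<subseteq> B \<and> card A = n \<and> A' \<subseteq> B \<and> card A' = n \<longrightarrow>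
        S A \<inter> {..<Min (A \<union> A')} = S A' \<inter> {..<Min (A \<union> A')})"
    using assms(1) unfolding n_subtle_def
    by (elim conjE allE[of _ C] allE[of _ S]) (simp add: assms(2,3))
  then show ?thesis using that by (elim exE conjE) blast
qed

text \<open>If no limit lay between some \<open>\<delta>\<close> and \<open>\<kappa>\<close>, all
  ordinals in between would be successors. Mapping \<open>A\<close> to the singleton of the
  predecessor of \<open>Min A\<close> is regressive, yet sets with different minima disagree below
  the smaller one. Closure is immediate, as all limits below \<open>\<kappa>\<close> are
  taken.\<close>

lemma subtle_limits_club:
  fixes \<kappa> :: "'a::wellorder"
  assumes "n_subtle n \<kappa>" "n \<ge> 1"
  shows "closed_unbounded {\<delta>. \<delta> < \<kappa> \<and> limit_ordinal \<delta>} \<kappa>"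
proof -
  have lim: "limit_ordinal \<kappa>" using assms by (simp add: n_subtle_def)
  have "unbounded_below {\<delta>. \<delta> < \<kappa> \<and> limit_ordinal \<delta>} \<kappa>"
  proof (rule ccontr)
    assume "\<not> ?thesis"
    then obtain \<delta> where \<delta>: "\<delta> < \<kappa>" "\<And>\<beta>. \<delta> < \<beta> \<Longrightarrow> \<beta> < \<kappa> \<Longrightarrow> \<not> limit_ordinal \<beta>"
      by (auto simp: unbounded_below_def)
    define S where "S A = {\<alpha>. \<alpha> < Min A \<and> (\<forall>\<gamma><Min A. \<gamma> \<le> \<alpha>)}" for A :: "'a set"
    have "closed_unbounded {\<delta><..<\<kappa>} \<kappa>"
      unfolding closed_unbounded_def
    proof (intro conjI allI impI)
      show "unbounded_below {\<delta><..<\<kappa>} \<kappa>"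
        unfolding unbounded_below_def
      proof (intro allI impI)
        fix \<alpha> assume "\<alpha> < \<kappa>"
        then have "max \<alpha> \<delta> < \<kappa>" using \<delta> by simp
        then obtain \<beta> where "\<beta> < \<kappa>" "max \<alpha> \<delta> < \<beta>" using lim unfolding limit_ordinal_def by blast
        then show "\<exists>\<beta>\<in>{\<delta><..<\<kappa>}. \<alpha> < \<beta> \<and> \<beta> < \<kappa>" by (intro bexI[of _ \<beta>]) auto
      qed
      fix \<gamma> assume "\<gamma> < \<kappa>" "limit_ordinal \<gamma> \<and> unbounded_below {\<delta><..<\<kappa>} \<gamma>"
      then show "\<gamma> \<in> {\<delta><..<\<kappa>}"
        unfolding limit_ordinal_def unbounded_below_def by force
    qed auto
    moreover have "\<And>A. S A \<subseteq> {..<Min A}" by (auto simp: S_def)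
    ultimately obtain B where B: "B \<subseteq> {\<delta><..<\<kappa>}" "finite B" "card B = n + 1"
      "\<And>A A'. A \<subseteq> B \<Longrightarrow> card A = n \<Longrightarrow> A' \<subseteq> B \<Longrightarrow> card A' = n \<Longrightarrow>
              S A \<inter> {..<Min (A \<union> A')} = S A' \<inter> {..<Min (A \<union> A')}"
      using n_subtleE[OF assms(1)] by blast
    \<comment> \<open>Omitting the least and the greatest point gives \<open>n\<close>-element sets
      with union \<open>B\<close> and different minima, \<open>Min B\<close> for \<open>A'\<close>
      and a larger one for \<open>A\<close>.\<close>
    define A A' where "A = B - {Min B}" and "A' = B - {Max B}"
    have "B \<noteq> {}" using B by auto
    then have ne: "Min B \<in> B" "Max B \<in> B" using B(2) by auto
    have neq: "Min B \<noteq> Max B"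
    proof
      assume "Min B = Max B"
      then have "B \<subseteq> {Min B}" using B(2) by (metis Max_ge Min_le order_antisym singletonI subsetI)
      then show False using card_mono[of "{Min B}" B] B(3) assms(2) by simp
    qed
    have cards: "card A = n" "card A' = n" "A \<subseteq> B" "A' \<subseteq> B"
      using ne B(2,3) by (auto simp: A_def A'_def)
    have A'min: "Min A' = Min B"
      using ne neq B(2) by (intro Min_eqI) (auto simp: A'_def)
    have "A \<union> A' = B" using ne neq by (auto simp: A_def A'_def)
    then have eq: "S A \<inter> {..<Min B} = S A' \<inter> {..<Min B}" using B(4) cards by metis
    have "A \<noteq> {}" using cards assms(2) by auto
    then have "Min A \<in> A" using B(2) by (intro Min_in) (auto simp: A_def)
    then have less: "Min B < Min A" using B(2) by (auto simp: A_def order_less_le)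
    have "\<not> limit_ordinal (Min B)" "\<delta> < Min B" using ne(1) B(1) \<delta>(2) by auto
    then obtain \<alpha> where "\<alpha> < Min B" "\<forall>\<gamma><Min B. \<gamma> \<le> \<alpha>"
      unfolding limit_ordinal_def by (metis emptyE lessThan_iff not_less)
    then have "\<alpha> \<in> S A" using eq A'min by (auto simp: S_def)
    then show False using less \<open>\<alpha> < Min B\<close> by (auto simp: S_def)
  qed
  then show ?thesis by (auto simp: closed_unbounded_def)
qed

text \<open>Finitely many regressive set functions are coded into one inside each block of ordinals
  \<open>L + m\<close> (\<open>L\<close> zero or limit, \<open>m\<close> finite): membership of \<open>L + m\<close> in the \<open>i\<close>-th set becomes
  membership of \<open>L + (q m + i)\<close>. Limit ordinals are closed under this coding.\<close>

lemma subtle_simultaneous: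
  fixes \<kappa> :: "'a::wellorder" and S :: "'i \<Rightarrow> 'a set \<Rightarrow> 'a set"
  assumes "n_subtle n \<kappa>" "n \<ge> 1" "finite I"
    and reg: "\<And>i A. i \<in> I \<Longrightarrow> S i A \<subseteq> {..<Min A}"
  obtains B where "B \<subseteq> {..<\<kappa>}" "finite B" "card B = n + 1" "limit_ordinal (Min B)"
    "\<And>i A A'. i \<in> I \<Longrightarrow> A \<subseteq> B \<Longrightarrow> card A = n \<Longrightarrow> A' \<subseteq> B \<Longrightarrow> card A' = n \<Longrightarrow>
        S i A \<inter> {..<Min (A \<union> A')} = S i A' \<inter> {..<Min (A \<union> A')}"
proof -
  obtain h :: "'i \<Rightarrow> nat" and q where h: "bij_betw h I {..<q}"
    using ex_bij_betw_finite_nat[OF assms(3)] lessThan_atLeast0 by metis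
  then have hq: "h i < q" if "i \<in> I" for i using that bij_betwE by blast
  define S' where "S' A = {\<zeta>. \<zeta> < Min A \<and> (\<exists>L m i. no_pred L \<and> L < Min A \<and> i \<in> I \<and>
    \<zeta> = (succ_ord ^^ (q * m + h i)) L \<and> (succ_ord ^^ m) L \<in> S i A)}" for A
  have "\<And>A. S' A \<subseteq> {..<Min A}" by (auto simp: S'_def)
  then obtain B where B: "B \<subseteq> {\<delta>. \<delta> < \<kappa> \<and> limit_ordinal \<delta>}" "finite B" "card B = n + 1"
    "\<And>A A'. A \<subseteq> B \<Longrightarrow> card A = n \<Longrightarrow> A' \<subseteq> B \<Longrightarrow> card A' = n \<Longrightarrow>
            S' A \<inter> {..<Min (A \<union> A')} = S' A' \<inter> {..<Min (A \<union> A')}"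
    using n_subtleE[OF assms(1) subtle_limits_club[OF assms(1,2)]] by blast
  have limB: "no_pred b" if "b \<in> B" for b
    using that B(1) by (auto simp: limit_ordinal_def no_pred_def)
  have half: "\<xi> \<in> S i A'" if i: "i \<in> I" and A: "A \<subseteq> B" "card A = n" "A' \<subseteq> B" "card A' = n"
    and \<xi>: "\<xi> \<in> S i A" "\<xi> < Min (A \<union> A')" for i A A' \<xi>
  proof -
    have fin: "finite A" "finite A'" "A \<noteq> {}" "A' \<noteq> {}"
      using A B(2) assms(2) finite_subset by auto
    define u where "u = Min (A \<union> A')"
    \<comment> \<open>The cut \<open>u\<close> is itself a point of \<open>B\<close>, hence a limit,
      so the whole block of \<open>\<xi>\<close>, including the code \<open>\<zeta>\<close>, lies
      below it.\<close>
    have "u \<in> A \<union> A'" unfolding u_def using fin by (intro Min_in) auto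
    then have "no_pred u" using limB A by blast
    have mins: "u \<le> Min A" "u \<le> Min A'" using fin by (auto simp: u_def intro!: Min_antimono)
    obtain L m where L: "no_pred L" "\<xi> = (succ_ord ^^ m) L" "L \<le> \<xi>" using limit_decomposition by blast
    have "L < u" using L(3) \<xi>(2) by (simp add: u_def)
    define \<zeta> where "\<zeta> = (succ_ord ^^ (q * m + h i)) L"
    have "\<zeta> < u" unfolding \<zeta>_def by (rule no_pred_funpow) fact+
    then have "\<zeta> \<in> S' A" unfolding S'_def using L i \<xi>(1) \<open>L < u\<close> mins \<zeta>_def by fastforce
    then have "\<zeta> \<in> S' A'" using B(4)[OF A] \<open>\<zeta> < u\<close> by (auto simp: u_def)
    then obtain L' m' i' where L': "no_pred L'" "L' < Min A'" "i' \<in> I"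
      "\<zeta> = (succ_ord ^^ (q * m' + h i')) L'" "(succ_ord ^^ m') L' \<in> S i' A'"
      by (auto simp: S'_def)
    have "Min A' \<in> A'" using fin by simp
    then have "no_pred (Min A')" using limB A by blast
    then have *: "L = L' \<and> q * m + h i = q * m' + h i'"
      using limit_decomposition_unique[of "Min A'" L L'] L L' \<open>L < u\<close> mins \<zeta>_def by simp
    \<comment> \<open>Since \<open>h i < q\<close>, quotient and remainder by \<open>q\<close>
      recover \<open>m\<close> and the index.\<close>
    have "m = (q * m + h i) div q" "m' = (q * m' + h i') div q"
      "h i = (q * m + h i) mod q" "h i' = (q * m' + h i') mod q"
      using hq[OF i] hq[OF L'(3)] by simp_all
    then have "m = m'" "h i = h i'" using * by metis+
    then have "i = i'" using h i L'(3) by (auto simp: bij_betw_def inj_on_def)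
    then show ?thesis using L' L * \<open>m = m'\<close> by simp
  qed
  show ?thesis
  proof (rule that[OF _ B(2,3)])
    show "B \<subseteq> {..<\<kappa>}" using B(1) by auto
    have "Min B \<in> B" using B(2,3) by (intro Min_in) auto
    then show "limit_ordinal (Min B)" using B(1) by auto
    fix i A A' assume *: "i \<in> I" "A \<subseteq> B" "card A = n" "A' \<subseteq> B" "card A' = n"
    show "S i A \<inter> {..<Min (A \<union> A')} = S i A' \<inter> {..<Min (A \<union> A')}"
      using half[OF *] half[OF *(1,4,5,2,3)] by (auto simp: Un_commute)
  qed
qed

section \<open>Regularity below a subtle ordinal\<close>

definition same_order :: "'a::linorder list \<Rightarrow> 'b::linorder list \<Rightarrow> bool" where
  "same_order x y \<longleftrightarrow> length x = length y \<and>
     (\<forall>i<length x. \<forall>j<length x. x ! i < x ! j \<longleftrightarrow> y ! i < y ! j)"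

lemma same_order_map:
  fixes e :: "'a::linorder \<Rightarrow> 'b::linorder"
  assumes "strict_mono_on W e" "set x \<subseteq> W"
  shows "same_order (map e x) x"
  unfolding same_order_def using strict_mono_on_less_iff[OF assms(1)] assms(2)
  by (simp add: subset_iff)

lemma same_order_sym: "same_order x y \<Longrightarrow> same_order y x"
  by (auto simp: same_order_def)

lemma same_order_trans: "same_order x y \<Longrightarrow> same_order y z \<Longrightarrow> same_order x z"
  by (auto simp: same_order_def)

text \<open>In a linear order two entries are equal exactly when neither is below the other, so the
  comparisons in \<open>same_order\<close> settle both components.\<close>

lemma order_type_eq_iff:
  "length x = length y \<Longrightarrow> order_type x = order_type y \<longleftrightarrow> same_order x y"
  unfolding order_type_def same_order_def
  by (auto simp: set_eq_iff) (metis nat_neq_iff)+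

abbreviation ranks :: "'a::linorder list \<Rightarrow> nat list" where
  "ranks x \<equiv> map (rank_in (set x)) x"

text \<open>On \<open>J\<close>, \<open>g\<close> factors through \<open>f\<close> by choosing
  preimages.\<close>

lemma card_image_le_of_kernel:
  assumes "finite J" "\<And>i j. i \<in> J \<Longrightarrow> j \<in> J \<Longrightarrow> f i = f j \<Longrightarrow> g i = g j"
  shows "card (g ` J) \<le> card (f ` J)"
proof -
  have "g (inv_into J f (f j)) = g j" if "j \<in> J" for j
    using assms(2)[OF inv_into_into[OF imageI[OF that]] that] f_inv_into_f[OF imageI[OF that]] by blast
  then have "g ` J = (g \<circ> inv_into J f) ` (f ` J)" by (simp add: image_image)
  then show ?thesis using card_image_le[of "f ` J" "g \<circ> inv_into J f"] assms(1) by simp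
qed

text \<open>A rank counts distinct smaller entries. Their positions are the same in both tuples, and
  so are the coincidences among them.\<close>

lemma same_order_ranks:
  assumes "same_order x y"
  shows "ranks x = ranks y"
proof (rule nth_equalityI)
  have len: "length y = length x" using assms by (simp add: same_order_def)
  then show "length (ranks x) = length (ranks y)" by simp
  fix i assume "i < length (ranks x)"
  then have i: "i < length x" by simp
  define J where "J = {j. j < length x \<and> x ! j < x ! i}"
  have eq: "x ! j = x ! l \<longleftrightarrow> y ! j = y ! l" if "j < length x" "l < length x" for j l
    using assms that unfolding same_order_def by (metis less_irrefl neqE)
  have "finite J" by (simp add: J_def)
  moreover have "(x ! j = x ! l) = (y ! j = y ! l)" if "j \<in> J" "l \<in> J" for j l
    using eq that by (simp add: J_def)
  ultimately have "card (nth x ` J) = card (nth y ` J)"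
    using card_image_le_of_kernel[of J "nth x" "nth y"] card_image_le_of_kernel[of J "nth y" "nth x"]
    by (metis order.antisym)
  moreover have "{u \<in> set x. u < x ! i} = nth x ` J"
    by (auto simp: J_def in_set_conv_nth)
  moreover have "{u \<in> set y. u < y ! i} = nth y ` J"
    using assms i by (auto simp: J_def in_set_conv_nth same_order_def)
  ultimately show "ranks x ! i = ranks y ! i" using i len by (simp add: rank_in_def)
qed

text \<open>The increasing map that misses exactly \<open>j\<close> (a face map): it renumbers the
  \<open>n\<close> points that remain when point \<open>j\<close> is removed from
  \<open>n + 1\<close> points.\<close>

definition skip :: "nat \<Rightarrow> nat \<Rightarrow> nat" where
  "skip j i = (if i < j then i else Suc i)"

lemma skip_strict_mono: "strict_mono_on A (skip j)"
  by (auto simp: strict_mono_on_def skip_def)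

lemma skip_image: "j \<le> n \<Longrightarrow> skip j ` {..<n} = {..n} - {j}"
proof (intro set_eqI iffI)
  fix i assume "j \<le> n" "i \<in> {..n} - {j}"
  then have "i = skip j (if i < j then i else i - 1)" "(if i < j then i else i - 1) < n"
    by (auto simp: skip_def)
  then show "i \<in> skip j ` {..<n}" by blast
qed (auto simp: skip_def)

text \<open>A gap below the maximum can be closed by a shift, so the shifts reduce every tuple to its ranks.\<close>

lemma shift_invariant_ranks:
  assumes inv: "\<And>\<sigma> j. \<sigma> \<in> nlists k {..<n} \<Longrightarrow> j \<le> n \<Longrightarrow> T (map (skip j) \<sigma>) = T \<sigma>"
    and "\<tau> \<in> nlists k {..n}"
  shows "T \<tau> = T (ranks \<tau>)"
  using assms(2)
proof (induction "Max (set \<tau>)" arbitrary: \<tau> rule: less_induct)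
  case less
  show ?case
  proof (cases "\<exists>j. j \<notin> set \<tau> \<and> (\<exists>u\<in>set \<tau>. j < u)")
    case True
    then obtain j u where j: "j \<notin> set \<tau>" "u \<in> set \<tau>" "j < u" by blast
    \<comment> \<open>Entries above the gap \<open>j\<close> are lowered by one.
      \<open>skip j\<close> undoes this, and the maximum drops because \<open>u\<close> lies above
      \<open>j\<close>.\<close>
    define \<sigma> where "\<sigma> = map (\<lambda>u. if j < u then u - 1 else u) \<tau>"
    have bound: "v \<le> n" if "v \<in> set \<tau>" for v using nlistsE_set[OF less.prems] that by blast
    have \<sigma>: "\<sigma> \<in> nlists k {..<n}"
    proof (rule nlistsI)
      show "set \<sigma> \<subseteq> {..<n}"
      proof
        fix v assume "v \<in> set \<sigma>"
        then obtain w where "w \<in> set \<tau>" "v = (if j < w then w - 1 else w)" by (auto simp: \<sigma>_def)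
        then show "v \<in> {..<n}" using bound[of w] bound[OF j(2)] j by (cases "w = j") auto
      qed
      show "size \<sigma> = k" using nlistsE_length[OF less.prems] by (simp add: \<sigma>_def)
    qed
    have unskip: "map (skip j) \<sigma> = \<tau>"
      unfolding \<sigma>_def map_map using j(1) by (intro map_idI) (auto simp: skip_def)
    define m where "m = Max (set \<tau>)"
    have max: "v \<le> m" if "v \<in> set \<tau>" for v using that by (simp add: m_def)
    have "v < m" if v: "v \<in> set \<sigma>" for v
    proof -
      obtain w where "w \<in> set \<tau>" "v = (if j < w then w - 1 else w)"
        using v by (auto simp: \<sigma>_def)
      then show ?thesis using max[of w] max[OF j(2)] j(3) by auto
    qed
    moreover have "set \<sigma> \<noteq> {}" using j(2) by (auto simp: \<sigma>_def)
    ultimately have "Max (set \<sigma>) < Max (set \<tau>)" by (simp add: m_def[symmetric])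
    moreover have "\<sigma> \<in> nlists k {..n}" using \<sigma> by (auto simp: nlists_def)
    ultimately have "T \<sigma> = T (ranks \<sigma>)" by (rule less.hyps)
    moreover have "j \<le> n" using j bound by fastforce
    then have "T \<tau> = T \<sigma>" using inv[OF \<sigma>] unskip by metis
    moreover have "same_order \<tau> \<sigma>"
      using same_order_map[OF skip_strict_mono, of \<sigma> UNIV j] unskip by simp
    then have "ranks \<tau> = ranks \<sigma>" by (rule same_order_ranks)
    ultimately show ?thesis by (simp only:)
  next
    case False
    then have "{v \<in> set \<tau>. v < u} = {..<u}" if "u \<in> set \<tau>" for u using that by auto
    then have "ranks \<tau> = \<tau>" by (intro map_idI) (simp add: rank_in_def)
    then show ?thesis by (simp only:)
  qed
qed

lemma ranks_zero_mem:
  assumes "x \<noteq> []"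
  shows "0 \<in> set (ranks x)"
proof -
  have "{y \<in> set x. y < Min (set x)} = {}" using assms by (auto simp: not_less)
  then have "rank_in (set x) (Min (set x)) = 0" by (simp add: rank_in_def)
  moreover have "Min (set x) \<in> set x" using assms by simp
  ultimately show ?thesis by (metis image_eqI image_set)
qed

lemma lessThan_Int_eqD:
  fixes a b c :: "'a::linorder"
  assumes "{..<a} \<inter> {..<b} = {..<c} \<inter> {..<b}" "c < b"
  shows "a = c"
proof (rule antisym)
  have "c \<notin> {..<a} \<inter> {..<b}" unfolding assms(1) by simp
  then show "a \<le> c" using assms(2) by simp
  have "a \<notin> {..<c} \<inter> {..<b}" unfolding assms(1)[symmetric] by simp
  then show "c \<le> a" using assms(2) by auto
qed

text \<open>Removing different points from a homogeneous \<open>B\<close> of \<open>n + 1\<close>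
  points reads one index tuple as different \<open>k\<close>-tuples of \<open>B\<close>. Their
  values agree below \<open>Min B\<close>, and so do the truth values of being regressive; hence
  both depend only on the order type. Each order type has a representative containing
  \<open>Min B\<close>, whose value, if regressive, is below \<open>Min B\<close>, and there
  agreement is equality.\<close>

theorem subtle_regular:
  fixes \<kappa> :: "'a::wellorder" and f :: "'a list \<Rightarrow> 'a"
  assumes "n_subtle n \<kappa>" "n \<ge> 1" "k \<ge> 1"
  obtains B where "finite B" "card B = n + 1"
    "\<And>x y. x \<in> nlists k B \<Longrightarrow> y \<in> nlists k B \<Longrightarrow> same_order x y \<Longrightarrow>
       f x < Min (set x) \<Longrightarrow> f y = f x \<and> f x < Min B"
proof -
  define tup where "tup A \<sigma> = map (nth (sorted_list_of_set A)) \<sigma>" for A :: "'a set" and \<sigma>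
  \<comment> \<open>Two set functions for each index tuple: with \<open>c\<close> true the value as
    an initial segment, with \<open>c\<close> false the truth value of being regressive, coded as
    everything or nothing below \<open>Min A\<close>.\<close>
  define S where "S = (\<lambda>(\<sigma>, c) A. {\<xi>. \<xi> < Min A \<and>
    (if c then \<xi> < f (tup A \<sigma>) else f (tup A \<sigma>) < Min (set (tup A \<sigma>)))})"
  have fin: "finite (nlists k {..<n} \<times> (UNIV :: bool set))" by (simp add: finite_nlists)
  have reg: "S i A \<subseteq> {..<Min A}" for i A by (auto simp: S_def split: prod.split)
  obtain B where B: "B \<subseteq> {..<\<kappa>}" "finite B" "card B = n + 1" "limit_ordinal (Min B)"
    "\<And>i A A'. i \<in> nlists k {..<n} \<times> (UNIV :: bool set) \<Longrightarrow> A \<subseteq> B \<Longrightarrow> card A = n \<Longrightarrow>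
        A' \<subseteq> B \<Longrightarrow> card A' = n \<Longrightarrow>
        S i A \<inter> {..<Min (A \<union> A')} = S i A' \<inter> {..<Min (A \<union> A')}"
    by (rule subtle_simultaneous[where S = S, OF assms(1,2) fin reg]) (rule that)
  define b where "b = nth (sorted_list_of_set B)"
  have mono: "strict_mono_on {..n} b"
    using B(3) strict_sorted_list_of_set[of B]
    by (auto simp: b_def strict_mono_on_def sorted_wrt_iff_nth_less)
  have surj: "b ` {..n} = B"
    unfolding b_def using B(2,3) nth_image[of "n + 1" "sorted_list_of_set B"]
    by (simp add: lessThan_Suc_atMost[symmetric] lessThan_atLeast0)
  define b0 where "b0 = Min B"
  have "Min {..n} = 0" by (intro Min_eqI) auto
  then have "b0 = b 0"
    using strict_mono_on_Min[OF mono, of "{..n}"] surj by (simp add: b0_def)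
  define T where "T \<tau> = ({..<f (map b \<tau>)} \<inter> {..<b0}, f (map b \<tau>) < Min (set (map b \<tau>)))" for \<tau>
  have inv: "T (map (skip j) \<sigma>) = T \<sigma>" if \<sigma>: "\<sigma> \<in> nlists k {..<n}" and "j \<le> n" for \<sigma> j
  proof (cases "j = n")
    case True
    then have "map (skip j) \<sigma> = \<sigma>" using \<sigma> by (intro map_idI) (auto simp: nlists_def skip_def)
    then show ?thesis by (simp only:)
  next
    case False
    define A where "A j = B - {b j}" for j
    have tup: "tup (A j) \<sigma> = map b (map (skip j) \<sigma>)" if "j \<le> n" for j
    proof -
      have "strict_mono_on {..<n} (b \<circ> skip j)"
        using mono that by (auto simp: strict_mono_on_def skip_def)
      moreover have "b ` ({..n} - {j}) = b ` {..n} - b ` {j}"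
        using that by (intro inj_on_image_set_diff[OF strict_mono_on_imp_inj_on[OF mono]]) auto
      then have "A j = (b \<circ> skip j) ` {..<n}"
        unfolding image_comp[symmetric] skip_image[OF that] by (simp add: A_def surj)
      ultimately have "sorted_list_of_set (A j) = map (b \<circ> skip j) [0..<n]"
        using sorted_list_of_set_image_lessThan by metis
      then show ?thesis using \<sigma> by (auto simp: tup_def nlists_def)
    qed
    have cards: "A j \<subseteq> B" "card (A j) = n" if "j \<le> n" for j
      using that B(2,3) surj by (auto simp: A_def)
    \<comment> \<open>The comparison is with removal of the last point, which leaves the indices in
      \<open>\<sigma>\<close> as they are. The two sets cover \<open>B\<close>, so the cut is
      exactly at \<open>b0\<close>.\<close>
    have "b j \<noteq> b n" using strict_mono_on_eq[OF mono, of j n] False \<open>j \<le> n\<close> by auto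
    then have un: "A j \<union> A n = B" by (auto simp: A_def)
    have id: "map (skip n) \<sigma> = \<sigma>" using \<sigma> by (intro map_idI) (auto simp: nlists_def skip_def)
    have eq: "S (\<sigma>, c) (A j) \<inter> {..<b0} = S (\<sigma>, c) (A n) \<inter> {..<b0}" for c
      using B(5)[of "(\<sigma>, c)" "A j" "A n"] \<sigma> cards \<open>j \<le> n\<close> un by (simp add: b0_def)
    have le: "b0 \<le> Min (A j)" if "j \<le> n" for j
      using cards[OF that] B(2) assms(2) unfolding b0_def by (intro Min_antimono) auto
    \<comment> \<open>\<open>Min B\<close> is a limit, so there is a point below it, which tells
      everything from nothing.\<close>
    obtain \<xi> where \<xi>: "\<xi> < b0" using B(4) by (auto simp: limit_ordinal_def b0_def)
    have "S (\<sigma>, True) (A j) \<inter> {..<b0} = {..<f (map b (map (skip j) \<sigma>))} \<inter> {..<b0}" if "j \<le> n" for j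
      unfolding S_def tup[OF that, symmetric] using le[OF that] by (auto dest: less_le_trans)
    then have "{..<f (map b (map (skip j) \<sigma>))} \<inter> {..<b0} = {..<f (map b \<sigma>)} \<inter> {..<b0}"
      using eq[of True] \<open>j \<le> n\<close> id by (metis order_refl)
    moreover have "f (map b (map (skip j) \<sigma>)) < Min (set (map b (map (skip j) \<sigma>))) \<longleftrightarrow>
        f (map b \<sigma>) < Min (set (map b \<sigma>))"
    proof -
      have "\<xi> \<in> S (\<sigma>, False) (A j) \<longleftrightarrow> \<xi> \<in> S (\<sigma>, False) (A n)" using eq[of False] \<xi> by blast
      moreover have "\<xi> < Min (A j)" "\<xi> < Min (A n)" using \<xi> le[OF \<open>j \<le> n\<close>] le[of n] by auto
      ultimately show ?thesis unfolding S_def using tup[OF \<open>j \<le> n\<close>] tup[of n] id by simp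
    qed
    ultimately show ?thesis by (simp only: T_def)
  qed
  have idx: "\<exists>\<tau>. x = map b \<tau> \<and> T \<tau> = T (ranks x)" if x: "x \<in> nlists k B" for x
  proof -
    define \<tau> where "\<tau> = map (inv_into {..n} b) x"
    have "map (b \<circ> inv_into {..n} b) x = x"
      using x surj by (intro map_idI) (auto simp: nlists_def intro!: f_inv_into_f)
    then have xb: "x = map b \<tau>" by (simp add: \<tau>_def)
    have \<tau>: "\<tau> \<in> nlists k {..n}"
      using x surj inv_into_into[of _ b "{..n}"] by (auto simp: nlists_def \<tau>_def)
    then have "same_order x \<tau>" using same_order_map[OF mono] xb by (simp add: nlists_def)
    then have "ranks x = ranks \<tau>" by (rule same_order_ranks)
    moreover have "T \<tau> = T (ranks \<tau>)" using inv \<tau> by (rule shift_invariant_ranks)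
    ultimately show ?thesis using xb by metis
  qed
  have key: "f x = f (map b (ranks x)) \<and> f x < b0"
    if x: "x \<in> nlists k B" and less: "f x < Min (set x)" for x
  proof -
    obtain \<tau> where \<tau>: "x = map b \<tau>" "T \<tau> = T (ranks x)" using idx[OF x] by blast
    have "x \<noteq> []" using x assms(3) by (auto simp: nlists_def)
    \<comment> \<open>Ranks start at 0, so the representative \<open>map b (ranks x)\<close>
      contains the least point of \<open>B\<close>; being regressive there means a value below
      \<open>b0\<close>.\<close>
    then have "b0 \<in> set (map b (ranks x))"
      using imageI[OF ranks_zero_mem, of x b] \<open>b0 = b 0\<close> by (simp add: image_image)
    then have "Min (set (map b (ranks x))) \<le> b0" by (intro Min_le) auto
    moreover have "f (map b (ranks x)) < Min (set (map b (ranks x)))"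
      using \<tau> less unfolding T_def by simp
    ultimately have lt: "f (map b (ranks x)) < b0" by (rule less_le_trans[rotated])
    have "{..<f x} \<inter> {..<b0} = {..<f (map b (ranks x))} \<inter> {..<b0}"
      using \<tau> unfolding T_def by simp
    then have "f x = f (map b (ranks x))"
      using lt by (rule lessThan_Int_eqD)
    then show ?thesis using lt by simp
  qed
  have reg_eq: "f y < Min (set y)"
    if x: "x \<in> nlists k B" and y: "y \<in> nlists k B" and o: "same_order x y"
      and less: "f x < Min (set x)" for x y
  proof -
    obtain \<sigma> \<tau> where \<sigma>: "x = map b \<sigma>" "T \<sigma> = T (ranks x)" and \<tau>: "y = map b \<tau>" "T \<tau> = T (ranks y)"
      using idx[OF x] idx[OF y] by blast
    then have "T \<sigma> = T \<tau>" using same_order_ranks[OF o] by simp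
    then show ?thesis using less \<sigma>(1) \<tau>(1) unfolding T_def by simp
  qed
  show ?thesis
  proof (rule that[OF B(2,3)])
    fix x y
    assume xy: "x \<in> nlists k B" "y \<in> nlists k B" "same_order x y" and less: "f x < Min (set x)"
    show "f y = f x \<and> f x < Min B"
      using key[OF xy(1) less] key[OF xy(2) reg_eq[OF xy less]] same_order_ranks[OF xy(3)]
      unfolding b0_def by argo
  qed
qed

section \<open>Label functions on a well-ordered type\<close>

definition descending :: "nat \<Rightarrow> nat \<Rightarrow> 'a::linorder inst set \<Rightarrow> bool" where
  "descending k r Q \<longleftrightarrow> Q \<subseteq> instances k r UNIV \<and> (\<forall>z ys v. Inst z ys v \<in> Q \<longrightarrow>
     v \<in> snd ` set ys \<and> (\<forall>y\<in>fst ` set ys. Max (set y) < Max (set z)))"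

lemma descendingD:
  assumes "descending k r Q" "Inst z ys v \<in> Q"
  shows "z \<in> nlists k UNIV" "ys \<in> nlists r (nlists k UNIV \<times> UNIV)" "v \<in> snd ` set ys"
    "\<And>y. y \<in> fst ` set ys \<Longrightarrow> Max (set y) < Max (set z)"
proof -
  have "Inst z ys v \<in> instances k r UNIV" using assms by (auto simp: descending_def)
  then show "z \<in> nlists k UNIV" "ys \<in> nlists r (nlists k UNIV \<times> UNIV)" by (auto simp: instances_def)
  show "v \<in> snd ` set ys" "\<And>y. y \<in> fst ` set ys \<Longrightarrow> Max (set y) < Max (set z)"
    using assms unfolding descending_def by blast+
qed

text \<open>A tuple without selected values passes its minimum on to later tuples but is labelled by
  its maximum, so its own label is not regressive.\<close>

definition least_or_min :: "'a::wellorder set \<Rightarrow> 'a list \<Rightarrow> 'a" where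
  "least_or_min X y = (if X = {} then Min (set y) else (LEAST v. v \<in> X))"

definition least_or_max :: "'a::wellorder set \<Rightarrow> 'a list \<Rightarrow> 'a" where
  "least_or_max X y = (if X = {} then Max (set y) else (LEAST v. v \<in> X))"

text \<open>The sets \<open>\<Phi>\<^sub>z\<close> of the full graph on all \<open>k\<close>-tuples, whose recursion is still well-founded
  over a well-order.\<close>

definition sel_values :: "'a::wellorder inst set \<Rightarrow> 'a list \<Rightarrow> 'a set" where
  "sel_values Q = wfrec (inv_image {(x, y). x < y} (\<lambda>z. Max (set z)))
     (\<lambda>\<phi> z. {v. \<exists>ys. Inst z (map (\<lambda>y. (y, least_or_min (\<phi> y) y)) ys) v \<in> Q})"

abbreviation sel_input :: "'a::wellorder inst set \<Rightarrow> 'a list \<Rightarrow> 'a" where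
  "sel_input Q y \<equiv> least_or_min (sel_values Q y) y"

abbreviation sel_label :: "'a::wellorder inst set \<Rightarrow> 'a list \<Rightarrow> 'a" where
  "sel_label Q y \<equiv> least_or_max (sel_values Q y) y"

abbreviation sel_inst :: "'a::wellorder inst set \<Rightarrow> 'a list \<Rightarrow> 'a list list \<Rightarrow> 'a \<Rightarrow> 'a inst" where
  "sel_inst Q z ys v \<equiv> Inst z (map (\<lambda>y. (y, sel_input Q y)) ys) v"

text \<open>Instances in \<open>Q\<close> only use tuples of smaller maximum; a list with any other
  tuple yields no instance, whatever the inputs are.\<close>

lemma sel_values_rec:
  assumes "descending k r Q"
  shows "sel_values Q z = {v. \<exists>ys. sel_inst Q z ys v \<in> Q}"
proof -
  let ?R = "inv_image {(x, y). x < y} (\<lambda>z :: 'a list. Max (set z))"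
  let ?c = "cut (sel_values Q) ?R z"
  have "wf ?R" by (intro wf_inv_image wellorder_class.wf)
  then have "sel_values Q z = {v. \<exists>ys. Inst z (map (\<lambda>y. (y, least_or_min (?c y) y)) ys) v \<in> Q}"
    unfolding sel_values_def by (subst wfrec) simp_all
  moreover have "Inst z (map (\<lambda>y. (y, least_or_min (?c y) y)) ys) v \<in> Q \<longleftrightarrow> sel_inst Q z ys v \<in> Q" for ys v
  proof (cases "\<forall>y\<in>set ys. Max (set y) < Max (set z)")
    case True
    then have "map (\<lambda>y. (y, least_or_min (?c y) y)) ys = map (\<lambda>y. (y, sel_input Q y)) ys"
      by (intro map_cong refl) (simp add: cut_def)
    then show ?thesis by (simp only:)
  next
    case False
    then show ?thesis using descendingD(4)[OF assms] by (fastforce simp: image_image)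
  qed
  ultimately show ?thesis by (simp only:)
qed

lemma sel_label_mem: "sel_values Q z \<noteq> {} \<Longrightarrow> sel_label Q z \<in> sel_values Q z"
  unfolding least_or_max_def using LeastI_ex[of "\<lambda>v. v \<in> sel_values Q z"] by auto

text \<open>A smaller domain selects fewer values, which can raise a label or turn it into the
  default. One list inside the domain realising the least value rules out both.\<close>

definition witness_closed :: "'a::wellorder inst set \<Rightarrow> 'a list set \<Rightarrow> bool" where
  "witness_closed Q D \<longleftrightarrow> (\<forall>z\<in>D. sel_values Q z \<noteq> {} \<longrightarrow>
     (\<exists>ys. set ys \<subseteq> D \<and> sel_inst Q z ys (sel_label Q z) \<in> Q))"

lemma witness_closed_Union:
  assumes "\<And>i. i \<in> I \<Longrightarrow> witness_closed Q (D i)"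
  shows "witness_closed Q (\<Union>i\<in>I. D i)"
  unfolding witness_closed_def
proof (intro ballI impI)
  fix z assume "z \<in> (\<Union>i\<in>I. D i)" "sel_values Q z \<noteq> {}"
  then obtain i ys where "i \<in> I" "set ys \<subseteq> D i" "sel_inst Q z ys (sel_label Q z) \<in> Q"
    using assms unfolding witness_closed_def by blast
  then show "\<exists>ys. set ys \<subseteq> (\<Union>i\<in>I. D i) \<and> sel_inst Q z ys (sel_label Q z) \<in> Q" by blast
qed

lemma witness_closed_insert:
  assumes "witness_closed Q D" "set ys \<subseteq> D" "sel_inst Q z ys (sel_label Q z) \<in> Q"
  shows "witness_closed Q (insert z D)"
  unfolding witness_closed_def
proof (intro ballI impI)
  fix u assume "u \<in> insert z D" "sel_values Q u \<noteq> {}"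
  then consider "u = z" | us where "set us \<subseteq> D" "sel_inst Q u us (sel_label Q u) \<in> Q"
    using assms(1) unfolding witness_closed_def by blast
  then show "\<exists>us. set us \<subseteq> insert z D \<and> sel_inst Q u us (sel_label Q u) \<in> Q"
    using assms(2,3) by cases blast+
qed

text \<open>One finite list of witnesses suffices for each tuple, and the witnesses have smaller
  maximum; so \<open>z\<close> together with finite closures of its witnesses is enough.\<close>

lemma ex_witness_closed:
  fixes Q :: "'a::wellorder inst set"
  assumes "descending k r Q"
  shows "z \<in> nlists k UNIV \<Longrightarrow>
    \<exists>D. finite D \<and> D \<subseteq> nlists k UNIV \<and> z \<in> D \<and> witness_closed Q D"
proof (induction "Max (set z)" arbitrary: z rule: less_induct)
  case less
  show ?case
  proof (cases "sel_values Q z = {}")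
    case True
    then show ?thesis using less.prems by (intro exI[of _ "{z}"]) (simp add: witness_closed_def)
  next
    case False
    then obtain ys where ys: "sel_inst Q z ys (sel_label Q z) \<in> Q"
      using sel_label_mem sel_values_rec[OF assms] by blast
    have "\<forall>y\<in>set ys. \<exists>D. finite D \<and> D \<subseteq> nlists k UNIV \<and> y \<in> D \<and> witness_closed Q D"
    proof
      fix y assume y: "y \<in> set ys"
      then have "Max (set y) < Max (set z)"
        using descendingD(4)[OF assms ys, of y] by (simp add: image_image)
      moreover have "y \<in> nlists k UNIV"
        using nlistsE_set[OF descendingD(2)[OF assms ys]] y by auto
      ultimately show "\<exists>D. finite D \<and> D \<subseteq> nlists k UNIV \<and> y \<in> D \<and> witness_closed Q D"
        by (rule less.hyps)
    qed
    then obtain D where D: "\<And>y. y \<in> set ys \<Longrightarrow> finite (D y) \<and> D y \<subseteq> nlists k UNIV \<and> y \<in> D y \<and>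
        witness_closed Q (D y)" by metis
    define D' where "D' = (\<Union>y\<in>set ys. D y)"
    have "witness_closed Q D'" unfolding D'_def using D by (intro witness_closed_Union) blast
    moreover have "set ys \<subseteq> D'" using D by (auto simp: D'_def)
    ultimately have "witness_closed Q (insert z D')"
      using ys by (rule witness_closed_insert)
    then show ?thesis
      using D less.prems by (intro exI[of _ "insert z D'"]) (auto simp: D'_def)
  qed
qed

section \<open>Transfer to finite graphs of integer tuples\<close>

definition graph_insts :: "(nat list \<times> nat list) set \<Rightarrow> selection \<Rightarrow> nat inst set" where
  "graph_insts \<Theta> F = {Inst z ys v | z ys v. F (z, ys) = Some v \<and> (\<forall>y\<in>fst ` set ys. (z, y) \<in> \<Theta>)}"

lemma descending_graph_insts:
  assumes "downward_lattice_graph k \<Theta>" "partial_selection k r F"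
  shows "descending k r (graph_insts \<Theta> F)"
proof -
  have "Inst z ys v \<in> instances k r UNIV \<and> v \<in> snd ` set ys \<and>
      (\<forall>y\<in>fst ` set ys. Max (set y) < Max (set z))" if "Inst z ys v \<in> graph_insts \<Theta> F" for z ys v
  proof -
    have F: "F (z, ys) = Some v" "\<forall>y\<in>fst ` set ys. (z, y) \<in> \<Theta>"
      using that by (auto simp: graph_insts_def)
    then have "(z, ys) \<in> nlists k UNIV \<times> nlists r (nlists k UNIV \<times> UNIV)"
      using assms(2) unfolding partial_selection_def by blast
    moreover obtain i where "i < r" "v = snd (ys ! i)"
      using F(1) assms(2) unfolding partial_selection_def by blast
    ultimately show ?thesis
      using F(2) assms(1) nlistsE_length[of ys r]
      by (fastforce simp: instances_def downward_lattice_graph_def)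
  qed
  moreover have "\<exists>z ys v. s = Inst z ys v" for s :: "nat inst" by (cases s) simp
  ultimately show ?thesis unfolding descending_def by (metis subsetI)
qed

definition pull_insts :: "nat \<Rightarrow> nat \<Rightarrow> nat set \<Rightarrow> nat inst set \<Rightarrow> 'a::linorder inst set" where
  "pull_insts k r H R = {s \<in> instances k r UNIV.
     \<exists>e. strict_mono_on (set_inst s) e \<and> e ` set_inst s \<subseteq> H \<and> map_inst e s \<in> R}"

lemma Inst_in_instances_UNIV:
  "Inst z ys v \<in> instances k r UNIV \<longleftrightarrow>
     length z = k \<and> length ys = r \<and> (\<forall>y\<in>set ys. length (fst y) = k)"
  by (auto simp: instances_def nlists_def subset_iff)

lemma map_inst_in_instances_UNIV:
  "map_inst e s \<in> instances k r UNIV \<longleftrightarrow> s \<in> instances k r UNIV"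
  by (cases s) (simp add: Inst_in_instances_UNIV)

text \<open>Membership is defined by an embedding chosen for each instance separately; by invariance
  one embedding of \<open>W\<close> decides all instances with coordinates in
  \<open>W\<close>.\<close>

lemma pull_insts_iff:
  fixes s :: "'a::linorder inst" and e :: "'a \<Rightarrow> nat"
  assumes "order_invariant H R (instances k r (UNIV :: 'a set))" "R \<subseteq> instances k r UNIV"
    and "strict_mono_on W e" "e ` W \<subseteq> H" "set_inst s \<subseteq> W"
  shows "s \<in> pull_insts k r H R \<longleftrightarrow> map_inst e s \<in> R"
proof -
  have e: "strict_mono_on (set_inst s) e" "e ` set_inst s \<subseteq> H"
    using assms(3-5) by (auto intro: monotone_on_subset)
  have "s \<in> instances k r UNIV" if "map_inst e s \<in> R"
    using that assms(2) map_inst_in_instances_UNIV by blast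
  then show ?thesis
    using assms(1) e unfolding pull_insts_def order_invariant_def by blast
qed

text \<open>Both conditions concern only equality and order of coordinates, which an increasing map
  reflects; \<open>k \<ge> 1\<close> gives every tuple a maximum.\<close>

lemma descending_pull_insts:
  assumes "descending k r R" "k \<ge> 1"
  shows "descending k r (pull_insts k r H R :: 'a::linorder inst set)"
proof -
  have "v \<in> snd ` set ys \<and> (\<forall>y\<in>fst ` set ys. Max (set y) < Max (set z))"
    if Q: "Inst z ys v \<in> (pull_insts k r H R :: 'a inst set)" for z ys v
  proof -
    let ?s = "set_inst (Inst z ys v)"
    obtain e where e: "strict_mono_on ?s e" "map_inst e (Inst z ys v) \<in> R"
      and inst: "Inst z ys v \<in> instances k r UNIV"
      using Q unfolding pull_insts_def by blast
    have R: "Inst (map e z) (map (map_prod (map e) e) ys) (e v) \<in> R" using e(2) by simp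
    have "e v \<in> e ` snd ` set ys"
      using descendingD(3)[OF assms(1) R] by (simp add: image_image)
    then obtain n where "e v = e n" "n \<in> snd ` set ys" by (rule imageE)
    moreover have "n \<in> ?s" "v \<in> ?s" using \<open>n \<in> snd ` set ys\<close> by force+
    ultimately have "v \<in> snd ` set ys" using strict_mono_on_eq[OF e(1)] by metis
    moreover have "Max (set y) < Max (set z)" if y: "y \<in> fst ` set ys" for y
    proof -
      have sub: "set y \<subseteq> ?s" "set z \<subseteq> ?s" using y by force+
      have "length y = k" "length z = k"
        using inst y by (auto simp: Inst_in_instances_UNIV)
      then have ne: "set y \<noteq> {}" "set z \<noteq> {}" using assms(2) by auto
      have "Max (set (map e y)) < Max (set (map e z))"
        using descendingD(4)[OF assms(1) R, of "map e y"] y by (simp add: image_image image_iff) blast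
      then have "e (Max (set y)) < e (Max (set z))"
        using strict_mono_on_Max[OF e(1)] sub ne by simp
      moreover have "Max (set y) \<in> ?s" "Max (set z) \<in> ?s"
        using Max_in[OF _ ne(1)] Max_in[OF _ ne(2)] sub by blast+
      ultimately show ?thesis using strict_mono_on_less_iff[OF e(1)] by blast
    qed
    ultimately show ?thesis by blast
  qed
  then show ?thesis unfolding descending_def by (auto simp: pull_insts_def)
qed

lemma subset_image_lists:
  assumes "set ys \<subseteq> f ` D"
  obtains xs where "set xs \<subseteq> D" "ys = map f xs"
proof -
  have "ys \<in> lists (f ` D)" using assms by auto
  then show ?thesis using that unfolding lists_image by auto
qed

text \<open>The values selected inside the image of \<open>D\<close> are the images of those with
  witnesses in \<open>D\<close>. By \<open>witness_closed\<close> the latter have the same least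
  element as the full set of values, or both sets are empty. Inputs must lie in \<open>W\<close>
  because they are coordinates of instances.\<close>

theorem label_fun_embedding:
  fixes \<Theta> F k r H and D :: "'a::wellorder list set" and e :: "'a \<Rightarrow> nat"
  defines "R \<equiv> graph_insts \<Theta> F"
  defines "Q \<equiv> pull_insts k r H R"
  assumes graph: "downward_lattice_graph k \<Theta>" "partial_selection k r F" "k \<ge> 1"
    and inv: "order_invariant H R (instances k r (UNIV :: 'a set))"
    and D: "D \<subseteq> nlists k UNIV" "witness_closed Q D"
    and W: "\<And>z. z \<in> D \<Longrightarrow> set z \<subseteq> W" "sel_input Q ` D \<subseteq> W"
    and e: "strict_mono_on W e" "e ` W \<subseteq> H"
  shows "z \<in> D \<Longrightarrow> label_fun r \<Theta> F (map e ` D) (map e z) = Some (e (sel_label Q z))"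
proof -
  let ?P = "Phi r \<Theta> F (map e ` D)"
  note descR = descending_graph_insts[OF graph(1,2), folded R_def]
  note descQ = descending_pull_insts[OF descR graph(3), of H, where 'a = 'a, folded Q_def]
  have ne: "set y \<noteq> {}" if "y \<in> D" for y using that D(1) graph(3) by (auto simp: nlists_def)
  have QR: "sel_inst Q z ys v \<in> Q \<longleftrightarrow>
      Inst (map e z) (map (\<lambda>y. (map e y, e (sel_input Q y))) ys) (e v) \<in> R"
    if "z \<in> D" "set ys \<subseteq> D" "v \<in> W" for z ys v
  proof -
    have "set_inst (sel_inst Q z ys v) \<subseteq> W" using that W by fastforce
    then have "sel_inst Q z ys v \<in> Q \<longleftrightarrow> map_inst e (sel_inst Q z ys v) \<in> R"
      unfolding Q_def by (intro pull_insts_iff[OF inv _ e]) (use descR in \<open>auto simp: descending_def\<close>)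
    then show ?thesis by (simp add: comp_def)
  qed
  \<comment> \<open>Emptiness is part of the induction because it decides whether a neighbour passes
    on its label or its minimum.\<close>
  have "(?P (map e z) = {} \<longleftrightarrow> sel_values Q z = {}) \<and>
      label_fun r \<Theta> F (map e ` D) (map e z) = Some (e (sel_label Q z))" if "z \<in> D" for z
    using that
  proof (induction "Max (set z)" arbitrary: z rule: less_induct)
    case less
    define X where "X = {v. \<exists>ys. set ys \<subseteq> D \<and> sel_inst Q z ys v \<in> Q}"
    have XW: "X \<subseteq> W"
    proof
      fix v assume "v \<in> X"
      then obtain ys where "set ys \<subseteq> D" "sel_inst Q z ys v \<in> Q" by (auto simp: X_def)
      then show "v \<in> W" using descendingD(3)[OF descQ, of z] W(2) by (fastforce simp: image_image)
    qed
    let ?in = "\<lambda>y. if ?P y \<noteq> {} then the (label_fun r \<Theta> F (map e ` D) y) else min_t y"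
    have input: "?in (map e y) = e (sel_input Q y)" if "y \<in> D" "Max (set y) < Max (set z)" for y
      using less.hyps[OF that(2,1)] strict_mono_on_Min[OF e(1) W(1)[OF that(1)] _ ne[OF that(1)]]
      by (simp add: least_or_min_def least_or_max_def)
    have "?P (map e z) = e ` X"
    proof (intro set_eqI iffI)
      fix v assume "v \<in> ?P (map e z)"
      then obtain zs where zs: "zs \<in> nlists r (out_nbrs \<Theta> (map e ` D) (map e z))"
        "F (map e z, map (\<lambda>y. (y, ?in y)) zs) = Some v"
        unfolding Phi_rec[OF graph(1), of r F "map e ` D" "map e z"] by blast
      have sub: "set zs \<subseteq> map e ` D" "\<And>y. y \<in> set zs \<Longrightarrow> (map e z, y) \<in> \<Theta>"
        using nlistsE_set[OF zs(1)] by (auto simp: out_nbrs_def)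
      obtain ys where ys: "set ys \<subseteq> D" "zs = map (map e) ys" using subset_image_lists[OF sub(1)] .
      have less_z: "Max (set y) < Max (set z)" if "y \<in> set ys" for y
      proof -
        have y: "y \<in> D" using that ys by blast
        have "Max (set (map e y)) < Max (set (map e z))"
          using sub(2)[of "map e y"] that ys graph(1) by (auto simp: downward_lattice_graph_def)
        then show ?thesis
          using strict_mono_on_Max[OF e(1) W(1) _ ne] y less.prems
            strict_mono_on_less_iff[OF e(1), of "Max (set y)" "Max (set z)"] W(1) ne Max_in
          by (metis finite_set set_map subsetD)
      qed
      have "?in (map e y) = e (sel_input Q y)" if "y \<in> set ys" for y
        using that ys(1) by (intro input less_z) auto
      then have eq: "map (\<lambda>y. (y, ?in y)) zs = map (\<lambda>y. (map e y, e (sel_input Q y))) ys"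
        unfolding ys(2) map_map comp_def by (intro map_cong refl) (simp only:)
      have R: "Inst (map e z) (map (\<lambda>y. (map e y, e (sel_input Q y))) ys) v \<in> R"
        using zs(2) sub(2) ys(2) unfolding eq R_def graph_insts_def by auto
      \<comment> \<open>So far \<open>v\<close> is an arbitrary integer. As a selected value it
        equals an input, hence is an image under \<open>e\<close>, and the instance can be pulled
        back.\<close>
      then obtain y where "y \<in> set ys" "v = e (sel_input Q y)"
        using descendingD(3)[OF descR] by fastforce
      moreover then have "sel_input Q y \<in> W" using ys(1) W(2) by blast
      ultimately show "v \<in> e ` X"
        using R QR[OF less.prems ys(1)] ys(1) unfolding X_def by blast
    next
      fix v assume "v \<in> e ` X"
      then obtain u ys where u: "u \<in> X" "v = e u" "set ys \<subseteq> D" "sel_inst Q z ys u \<in> Q"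
        by (auto simp: X_def)
      have R: "Inst (map e z) (map (\<lambda>y. (map e y, e (sel_input Q y))) ys) v \<in> R"
        using QR[OF less.prems u(3)] u XW by blast
      have less_z: "Max (set y) < Max (set z)" if "y \<in> set ys" for y
        using descendingD(4)[OF descQ u(4), of y] that by (simp add: image_image)
      have "?in (map e y) = e (sel_input Q y)" if "y \<in> set ys" for y
        using that u(3) by (intro input less_z) auto
      then have eq: "map (\<lambda>y. (y, ?in y)) (map (map e) ys) = map (\<lambda>y. (map e y, e (sel_input Q y))) ys"
        unfolding map_map comp_def by (intro map_cong refl) (simp only:)
      have F: "F (map e z, map (\<lambda>y. (y, ?in y)) (map (map e) ys)) = Some v"
        "\<And>y. y \<in> set ys \<Longrightarrow> (map e z, map e y) \<in> \<Theta>"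
        using R unfolding eq R_def graph_insts_def by auto
      have "length ys = r" using nlistsE_length[OF descendingD(2)[OF descQ u(4)]] by simp
      then have "map (map e) ys \<in> nlists r (out_nbrs \<Theta> (map e ` D) (map e z))"
        using F(2) u(3) less.prems by (auto intro!: nlistsI imageI simp: out_nbrs_def)
      then show "v \<in> ?P (map e z)"
        unfolding Phi_rec[OF graph(1), of r F "map e ` D" "map e z"] using F(1) by blast
    qed
    moreover have XS: "X \<subseteq> sel_values Q z"
      unfolding X_def sel_values_rec[OF descQ, of z] by blast
    moreover have lX: "sel_label Q z \<in> X" if "sel_values Q z \<noteq> {}"
      using D(2) less.prems that unfolding witness_closed_def X_def by blast
    moreover have "Inf (e ` X) = e (sel_label Q z)" if S: "sel_values Q z \<noteq> {}"
    proof -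
      have "sel_label Q z \<le> v" if "v \<in> X" for v
        using XS that S by (auto simp: least_or_max_def intro: Least_le)
      then have "(LEAST v. v \<in> X) = sel_label Q z" by (intro Least_equality lX[OF S]) blast
      then show ?thesis using strict_mono_on_Least[OF e(1) XW lX[OF S]] by simp
    qed
    moreover have "Max (set (map e z)) = e (Max (set z))"
      using strict_mono_on_Max[OF e(1) W(1)[OF less.prems] _ ne[OF less.prems]] by simp
    ultimately show ?case
      using less.prems by (auto simp: label_fun_eq least_or_max_def)
  qed
  then show "z \<in> D \<Longrightarrow> label_fun r \<Theta> F (map e ` D) (map e z) = Some (e (sel_label Q z))" by blast
qed

section \<open>Regressive regularity of integer label functions\<close>

lemma ranks_in_nlists: "x \<in> nlists k U \<Longrightarrow> ranks x \<in> nlists k {..<k}"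
  using rank_in_less_card[of "set x"] card_length[of x]
  by (fastforce simp: nlists_def)

lemma same_order_of_ranks_eq:
  fixes x y :: "nat list"
  assumes "ranks x = ranks y"
  shows "same_order x y"
  using same_order_map[OF rank_in_strict_mono[of "set x"], of x]
    same_order_map[OF rank_in_strict_mono[of "set y"], of y] assms
  by (metis List.finite_set order_refl same_order_sym same_order_trans)

lemma card_nlists_le: "card (nlists k {..<k}) \<le> k ^ k"
  unfolding nlists_def using card_lists_length_eq[of "{..<k}" k] by (simp add: conj_commute)

text \<open>Tuples of one order type share a single regressive value, so sending each value to the
  ranks of a tuple attaining it is injective; there are at most \<open>k ^ k\<close> such rank
  tuples.\<close>

lemma card_regressive_values:
  assumes "regressively_regular k f E"
  shows "card (regressive_values f (nlists k E)) \<le> k ^ k"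
proof -
  let ?V = "regressive_values f (nlists k E)"
  have "\<forall>n\<in>?V. \<exists>x. x \<in> nlists k E \<and> f x = Some n \<and> n < min_t x"
    by (auto simp: regressive_values_def)
  then obtain w where w: "\<And>n. n \<in> ?V \<Longrightarrow> w n \<in> nlists k E \<and> f (w n) = Some n \<and> n < min_t (w n)"
    by metis
  have "inj_on (\<lambda>n. ranks (w n)) ?V"
  proof (rule inj_onI)
    fix m n assume mn: "m \<in> ?V" "n \<in> ?V" "ranks (w m) = ranks (w n)"
    have "length (w m) = k" "length (w n) = k" using w mn(1,2) nlistsE_length by blast+
    then have ot: "order_type (w m) = order_type (w n)" "order_type (w n) \<in> order_type ` nlists k UNIV"
      using same_order_of_ranks_eq[OF mn(3)] by (simp_all add: order_type_eq_iff in_nlists_UNIV)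
    have "\<not> the (f (w n)) \<ge> min_t (w n)" using w[OF mn(2)] by simp
    then have "the (f (w m)) = the (f (w n))"
      using assms ot w mn(1,2) unfolding regressively_regular_def by metis
    then show "m = n" using w mn(1,2) by simp
  qed
  moreover have "(\<lambda>n. ranks (w n)) ` ?V \<subseteq> nlists k {..<k}"
    using w by (auto intro!: ranks_in_nlists)
  ultimately have "card ?V \<le> card (nlists k {..<k})"
    by (rule card_inj_on_le) (simp add: finite_nlists)
  then show ?thesis using card_nlists_le order.trans by blast
qed

lemma regressively_regularI:
  assumes "nlists k E \<subseteq> dom f"
    and "\<And>x y. x \<in> nlists k E \<Longrightarrow> y \<in> nlists k E \<Longrightarrow> same_order x y \<Longrightarrow> the (f x) < min_t x \<Longrightarrow>
      the (f y) = the (f x) \<and> the (f x) < Min E"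
  shows "regressively_regular k f E"
  unfolding regressively_regular_def
proof (intro conjI ballI)
  fix ot
  show "(\<forall>x\<in>nlists k E. \<forall>y\<in>nlists k E. order_type x = ot \<and> order_type y = ot \<longrightarrow>
            the (f x) = the (f y) \<and> the (f y) < Min E) \<or>
        (\<forall>x\<in>nlists k E. order_type x = ot \<longrightarrow> the (f x) \<ge> min_t x)"
  proof (cases "\<exists>x\<in>nlists k E. order_type x = ot \<and> the (f x) < min_t x")
    case True
    then obtain x where x: "x \<in> nlists k E" "order_type x = ot" "the (f x) < min_t x" by blast
    have "the (f y) = the (f x) \<and> the (f x) < Min E" if "y \<in> nlists k E" "order_type y = ot" for y
      using assms(2)[OF x(1) that(1) _ x(3)] x(2) that(2) nlistsE_length[OF x(1)]
        nlistsE_length[OF that(1)] order_type_eq_iff[of x y] by simp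
    then show ?thesis by metis
  next
    case False
    then show ?thesis by (meson not_less)
  qed
qed (fact assms(1))

lemma ex_regressively_regular:
  assumes subtle: "\<forall>n\<ge>1. \<exists>\<kappa>::'a::wellorder. n_subtle_cardinal n \<kappa>"
    and p: "p \<ge> 2" and k: "k \<ge> 1"
    and graph: "downward_lattice_graph k \<Theta>" "partial_selection k r F"
  obtains f E where "f \<in> label_functions k r \<Theta> F" "finite E" "card E = p" "regressively_regular k f E"
proof -
  define R where "R = graph_insts \<Theta> F"
  obtain H where H: "infinite H" "order_invariant H R (instances k r (UNIV :: 'a set))"
    by (rule ex_order_invariant)
  define Q where "Q = (pull_insts k r H R :: 'a inst set)"
  have descQ: "descending k r Q"
    unfolding Q_def R_def by (intro descending_pull_insts descending_graph_insts graph k)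
  \<comment> \<open>A \<open>(p - 1)\<close>-subtle ordinal yields \<open>p\<close> points;
    \<open>p \<ge> 2\<close> keeps the index positive.\<close>
  obtain \<kappa> :: 'a where \<kappa>: "n_subtle (p - 1) \<kappa>"
    using subtle p unfolding n_subtle_cardinal_def by (metis One_nat_def diff_le_mono numeral_2_eq_2 diff_Suc_1)
  have p1: "1 \<le> p - 1" using p by simp
  obtain B where B: "finite B" "card B = p - 1 + 1"
    "\<And>x y. x \<in> nlists k B \<Longrightarrow> y \<in> nlists k B \<Longrightarrow> same_order x y \<Longrightarrow>
       sel_label Q x < Min (set x) \<Longrightarrow> sel_label Q y = sel_label Q x \<and> sel_label Q x < Min B"
    by (rule subtle_regular[where f = "sel_label Q", OF \<kappa> p1 k]) (rule that)
  have "B \<noteq> {}" using B(2) by auto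
  have "\<forall>x\<in>nlists k B. \<exists>D. finite D \<and> D \<subseteq> nlists k UNIV \<and> x \<in> D \<and> witness_closed Q D"
    using nlists_mono[OF subset_UNIV, of k B] by (intro ballI ex_witness_closed[OF descQ]) blast
  then obtain D where D: "\<And>x. x \<in> nlists k B \<Longrightarrow>
      finite (D x) \<and> D x \<subseteq> nlists k UNIV \<and> x \<in> D x \<and> witness_closed Q (D x)" by metis
  define D' where "D' = (\<Union>x\<in>nlists k B. D x)"
  have D': "D' \<subseteq> nlists k UNIV" "finite D'" "nlists k B \<subseteq> D'"
    using D finite_nlists[OF B(1)] by (auto simp: D'_def)
  have closed: "witness_closed Q D'" unfolding D'_def using D by (intro witness_closed_Union) blast
  \<comment> \<open>Labels join the coordinates and inputs so that \<open>e\<close> also preserves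
    their comparison with minima, in particular with \<open>Min B\<close>.\<close>
  define W where "W = \<Union> (set ` D') \<union> sel_input Q ` D' \<union> sel_label Q ` D' \<union> B"
  have "finite W" using D'(2) B(1) by (simp add: W_def)
  then obtain e :: "'a \<Rightarrow> nat" where e: "strict_mono_on W e" "e ` W \<subseteq> H"
    using ex_strict_mono_on_infinite[OF _ H(1)] by metis
  define f where "f = label_fun r \<Theta> F (map e ` D')"
  have f: "f (map e x) = Some (e (sel_label Q x))" if "x \<in> D'" for x
    unfolding f_def Q_def R_def
    by (rule label_fun_embedding[OF graph k, of H D' W e])
      (use that H(2) D'(1) closed e in \<open>auto simp: W_def Q_def R_def\<close>)
  have BW: "B \<subseteq> W" by (simp add: W_def)
  have E: "\<exists>x. x \<in> nlists k B \<and> z = map e x" if "z \<in> nlists k (e ` B)" for z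
    using subset_image_lists[OF nlistsE_set[OF that]] nlistsE_length[OF that]
    by (metis length_map nlistsI)
  have fx: "f (map e x) = Some (e (sel_label Q x))"
    "e (sel_label Q x) < min_t (map e x) \<longleftrightarrow> sel_label Q x < Min (set x)"
    if x: "x \<in> nlists k B" for x
  proof -
    have "x \<in> D'" using x D'(3) by blast
    then show "f (map e x) = Some (e (sel_label Q x))" by (rule f)
    have sub: "set x \<subseteq> W" "set x \<noteq> {}"
      using nlistsE_set[OF x] BW nlistsE_length[OF x] k by auto
    then have "Min (set x) \<in> W" using Min_in[of "set x"] by blast
    moreover have "sel_label Q x \<in> W" using \<open>x \<in> D'\<close> by (simp add: W_def)
    moreover have "min_t (map e x) = e (Min (set x))" using strict_mono_on_Min[OF e(1) sub(1) _ sub(2)] by simp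
    ultimately show "e (sel_label Q x) < min_t (map e x) \<longleftrightarrow> sel_label Q x < Min (set x)"
      using strict_mono_on_less_iff[OF e(1)] by simp
  qed
  have "regressively_regular k f (e ` B)"
  proof (rule regressively_regularI)
    show "nlists k (e ` B) \<subseteq> dom f" using E fx(1) by blast
    fix z w assume "z \<in> nlists k (e ` B)" "w \<in> nlists k (e ` B)" and o: "same_order z w"
      and less: "the (f z) < min_t z"
    then obtain x y where xy: "x \<in> nlists k B" "z = map e x" "y \<in> nlists k B" "w = map e y"
      using E by metis
    have so: "same_order (map e u) u" if "u \<in> nlists k B" for u
      using same_order_map[OF e(1), of u] nlistsE_set[OF that] BW by blast
    have "same_order x y"
      using so[OF xy(1)] so[OF xy(3)] o unfolding xy(2,4)
      by (meson same_order_sym same_order_trans)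
    moreover have "sel_label Q x < Min (set x)" using less fx[OF xy(1)] xy(2) by simp
    ultimately have "sel_label Q y = sel_label Q x" "sel_label Q x < Min B"
      using B(3)[OF xy(1,3)] by blast+
    moreover have "Min (e ` B) = e (Min B)" by (rule strict_mono_on_Min[OF e(1) BW B(1) \<open>B \<noteq> {}\<close>])
    moreover have "sel_label Q x \<in> W" "Min B \<in> W"
      using xy(1) D'(3) BW Min_in[OF B(1) \<open>B \<noteq> {}\<close>] by (auto simp: W_def)
    ultimately show "the (f w) = the (f z) \<and> the (f z) < Min (e ` B)"
      using fx(1)[OF xy(1)] fx(1)[OF xy(3)] xy(2,4) strict_mono_on_less_iff[OF e(1)] by simp
  qed
  moreover have "card (e ` B) = p"
    using B(2) p1 card_image[OF inj_on_subset[OF strict_mono_on_imp_inj_on[OF e(1)] BW]] by simp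
  moreover have "f \<in> label_functions k r \<Theta> F"
  proof -
    have "map e ` D' \<subseteq> nlists k UNIV" using D'(1) by (auto simp: in_nlists_UNIV)
    then show ?thesis using D'(2) unfolding label_functions_def f_def by blast
  qed
  ultimately show ?thesis using that B(1) by blast
qed

theorem theorem4p5:
  fixes r p k :: nat
    and \<Theta> :: "(nat list \<times> nat list) set"
    and F :: selection
  assumes subtle_axiom: "\<forall>n\<ge>1. \<exists>\<kappa>::'a::wellorder. n_subtle_cardinal n \<kappa>"
    and "r \<ge> 1" and "p \<ge> 2" and "k \<ge> 2"
    and "downward_lattice_graph k \<Theta>"
    and "partial_selection k r F"
  shows "(\<exists>f\<in>label_functions k r \<Theta> F. \<exists>E. finite E \<and> card E = p \<and> nlists k E \<subseteq> dom f \<and>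
            card (regressive_values f (nlists k E)) \<le> k ^ k) \<and>
         (\<exists>f\<in>label_functions k r \<Theta> F. \<exists>E. finite E \<and> card E = p \<and> regressively_regular k f E)"
proof -
  have "k \<ge> 1" using assms(4) by simp
  then obtain f E where f: "f \<in> label_functions k r \<Theta> F" "finite E" "card E = p"
    "regressively_regular k f E"
    using ex_regressively_regular[OF subtle_axiom assms(3) _ assms(5,6)] by metis
  moreover have "nlists k E \<subseteq> dom f" using f(4) by (simp add: regressively_regular_def)
  moreover have "card (regressive_values f (nlists k E)) \<le> k ^ k"
    using f(4) by (rule card_regressive_values)
  ultimately show ?thesis by blast
qed

end
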